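(* For $\alpha\in(0,1)$ let $$\mathcal F_\alpha:=\big\{f:\mathbb B\to\mathbb B\ :\ f\text{ is slice regular},\ f(0)=0,\ |f'(0)|=\alpha\big\},$$ for $f\in\mathcal F_\alpha$ let $$r_\alpha(f)=\sup\big\{r\ :\ f|_{B(0,r)}\text{ is injective}\big\},$$ and let $r(\mathcal F_\alpha)=\inf\{r_\alpha(f):f\in\mathcal F_\alpha\}$. For $0<r\le r(\mathcal F_\alpha)$ put $$R_\alpha(r)=r\,\frac{\alpha-r}{1-\alpha r}.$$ Consider also the functions of the form $$f(q)=q\,(1-q\alpha e^{-I\theta})^{-\ast}\ast(q-\alpha e^{I\theta})\,v\qquad (\mathrm E)$$ with $I\in\mathbb S$, $\theta\in\mathbb R$ and $v\in\partial\mathbb B$. Then: (a) for each $\alpha\in(0,1)$, $$r(\mathcal F_\alpha)=\frac{\alpha}{1+\sqrt{1-\alpha^2}};$$ (b) for each $\alpha\in(0,1)$ and each $f\in\mathcal F_\alpha$, $r_\alpha(f)\ge r(\mathcal F_\alpha)$, with equality if and only if $f$ is of the form $(\mathrm E)$ for some $I\in\mathbb S$, $\theta\in\mathbb R$ and $v\in\partial\mathbb B$; (c) for each $\alpha\in(0,1)$ and each $0<r\le r(\mathcal F_\alpha)$, $$\bigcap_{f\in\mathcal F_\alpha}f\big(B(0,r)\big)=B\big(0,R_\alpha(r)\big);$$ (d) for each $\alpha\in(0,1)$, $r\in(0,r(\mathcal F_\alpha))$ and $f\in\mathcal F_\alpha$, $$B\big(0,R_\alpha(r)\big)\subset f\big(B(0,r)\big).$$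 Moreover, $B(0,R_\alpha(r))$ is the largest ball centred at $0$ contained in the image set $f\big(B(0,r)\big)$ if and only if $f$ is of the form $(\mathrm E)$ for some $I\in\mathbb S$, $\theta\in\mathbb R$ and $v\in\partial\mathbb B$.
   Context: $\mathbb H$ is the skew field of quaternions, $|\cdot|$ its Euclidean norm, $\mathbb S=\{q\in\mathbb H:q^2=-1\}$, and $e^{I\theta}=\cos\theta+I\sin\theta$. For $I\in\mathbb S$, $\mathbb C_I=\mathbb R+\mathbb R I$, and for $\Omega\subset\mathbb H$, $\Omega_I=\Omega\cap\mathbb C_I$. $B(q_0,R)=\{q\in\mathbb H:|q-q_0|<R\}$ and $\mathbb B=B(0,1)$. A function $f:\Omega\to\mathbb H$ on a domain $\Omega\subset\mathbb H$ is slice regular if for every $I\in\mathbb S$ its restriction $f_I$ to $\Omega_I$ has continuous partial derivatives and satisfies $\frac12\big(\frac{\partial}{\partial x}+I\frac{\partial}{\partial y}\big)f_I(x+yI)=0$ for all $x+yI\in\Omega_I$. On $\mathbb B$ this is equivalent to $f(q)=\sum_{n\ge0}q^na_n$ with $a_n\in\mathbb H$, the series converging absolutely and uniformly on compact subsets of $\mathbb B$. The slice derivative is $f'(x+yI)=\frac12\big(\frac{\partial}{\partial x}-I\frac{\partial}{\partial y}\big)f_I(x+yI)$ on $\mathbb B_I$; equivalently $f'(q)=\sum_{n\ge1}q^{n-1}na_n$. For slice regular $f(q)=\sum q^na_n$, $g(q)=\sum q^nb_n$ on $\mathbb B$, the regular product is $f\ast g(q)=\sum_{n\ge0}q^n\big(\sum_{k=0}^na_kb_{n-k}\big)$;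 the regular conjugate is $f^c(q)=\sum q^n\overline{a_n}$; the symmetrization is $f^s=f\ast f^c=f^c\ast f$; and, for $f\not\equiv0$, the regular reciprocal is $f^{-\ast}(q)=f^s(q)^{-1}f^c(q)$, slice regular off the zero set of $f^s$. *)

theory Defs
  imports "HOL-Analysis.Analysis"
begin

datatype quat = Quat (qre: real) (qi: real) (qj: real) (qk: real)

lemma quat_eq_iff: "p = q \<longleftrightarrow> qre p = qre q \<and> qi p = qi q \<and> qj p = qj q \<and> qk p = qk q"
  by (cases p; cases q) simp

instantiation quat :: ring_1
begin

definition "0 = Quat 0 0 0 0"
definition "1 = Quat 1 0 0 0"
definition "p + q = Quat (qre p + qre q) (qi p + qi q) (qj p + qj q) (qk p + qk q)"
definition "- q = Quat (- qre q) (- qi q) (- qj q) (- qk q)"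
definition "p - q = Quat (qre p - qre q) (qi p - qi q) (qj p - qj q) (qk p - qk q)"
definition "p * q = Quat
  (qre p * qre q - qi p * qi q - qj p * qj q - qk p * qk q)
  (qre p * qi q + qi p * qre q + qj p * qk q - qk p * qj q)
  (qre p * qj q - qi p * qk q + qj p * qre q + qk p * qi q)
  (qre p * qk q + qi p * qj q - qj p * qi q + qk p * qre q)"

instance
  by standard
    (simp_all add: zero_quat_def one_quat_def plus_quat_def uminus_quat_def minus_quat_def
      times_quat_def, simp_all add: algebra_simps)

end

lemmas quat_arith_defs =
  zero_quat_def one_quat_def plus_quat_def uminus_quat_def minus_quat_def times_quat_def

lemma quat_sel [simp]:
  "qre 0 = 0" "qi 0 = 0" "qj 0 = 0" "qk 0 = 0"
  "qre 1 = 1" "qi 1 = 0" "qj 1 = 0" "qk 1 = 0"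
  "qre (p + q) = qre p + qre q" "qi (p + q) = qi p + qi q"
  "qj (p + q) = qj p + qj q" "qk (p + q) = qk p + qk q"
  "qre (- q) = - qre q" "qi (- q) = - qi q" "qj (- q) = - qj q" "qk (- q) = - qk q"
  "qre (p - q) = qre p - qre q" "qi (p - q) = qi p - qi q"
  "qj (p - q) = qj p - qj q" "qk (p - q) = qk p - qk q"
  by (simp_all add: quat_arith_defs)

instantiation quat :: real_vector
begin

definition "scaleR c q = Quat (c * qre q) (c * qi q) (c * qj q) (c * qk q)"

instance
  by standard (simp_all add: scaleR_quat_def plus_quat_def algebra_simps)

end

lemma quat_sel_scaleR [simp]:
  "qre (c *\<^sub>R q) = c * qre q" "qi (c *\<^sub>R q) = c * qi q"
  "qj (c *\<^sub>R q) = c * qj q" "qk (c *\<^sub>R q) = c * qk q"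
  by (simp_all add: scaleR_quat_def)

instantiation quat :: real_inner
begin

definition "inner p q = qre p * qre q + qi p * qi q + qj p * qj q + qk p * qk q"
definition "norm q = sqrt ((qre q)\<^sup>2 + (qi q)\<^sup>2 + (qj q)\<^sup>2 + (qk q)\<^sup>2)"
definition "sgn (q::quat) = q /\<^sub>R norm q"
definition "dist (p::quat) q = norm (p - q)"
definition "(uniformity :: (quat \<times> quat) filter) = (INF e\<in>{0<..}. principal {(p, q). dist p q < e})"
definition "open (U :: quat set) = (\<forall>p\<in>U. eventually (\<lambda>(p', q). p' = p \<longrightarrow> q \<in> U) uniformity)"

instance
proof
  fix p q :: quat
  show "dist p q = norm (p - q)" by (rule dist_quat_def)
  show "sgn p = p /\<^sub>R norm p" by (rule sgn_quat_def)
  show "uniformity = (INF e\<in>{0<..}. principal {(p::quat, q). dist p q < e})"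
    by (rule uniformity_quat_def)
  fix U :: "quat set"
  show "open U = (\<forall>p\<in>U. \<forall>\<^sub>F (p', q) in uniformity. p' = p \<longrightarrow> q \<in> U)"
    by (rule open_quat_def)
next
  fix p q r :: quat and a :: real
  show "p \<bullet> q = q \<bullet> p" "(p + q) \<bullet> r = p \<bullet> r + q \<bullet> r" "(a *\<^sub>R p) \<bullet> q = a * (p \<bullet> q)" "0 \<le> p \<bullet> p"
    by (simp_all add: inner_quat_def scaleR_quat_def algebra_simps)
  show "norm p = sqrt (p \<bullet> p)"
    by (simp add: inner_quat_def norm_quat_def power2_eq_square)
  have nonneg: "0 \<le> qre p * qre p" "0 \<le> qi p * qi p" "0 \<le> qj p * qj p" "0 \<le> qk p * qk p"
    by simp_all
  show "p \<bullet> p = 0 \<longleftrightarrow> p = 0"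
    using nonneg by (simp add: inner_quat_def quat_eq_iff add_nonneg_eq_0_iff)
qed

end

definition qcnj :: "quat \<Rightarrow> quat" where
  "qcnj q = Quat (qre q) (- qi q) (- qj q) (- qk q)"

lemma qcnj_sel [simp]:
  "qre (qcnj q) = qre q" "qi (qcnj q) = - qi q" "qj (qcnj q) = - qj q" "qk (qcnj q) = - qk q"
  by (simp_all add: qcnj_def)

lemma norm_quat_power2: "(norm q)\<^sup>2 = (qre q)\<^sup>2 + (qi q)\<^sup>2 + (qj q)\<^sup>2 + (qk q)\<^sup>2"
  by (simp add: norm_quat_def)

lemma mult_qcnj: "q * qcnj q = (norm q)\<^sup>2 *\<^sub>R 1" and qcnj_mult_self: "qcnj q * q = (norm q)\<^sup>2 *\<^sub>R 1"
  unfolding norm_quat_power2 by (simp_all add: quat_eq_iff times_quat_def power2_eq_square)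

instantiation quat :: real_normed_div_algebra
begin

definition "inverse q = qcnj q /\<^sub>R (norm q)\<^sup>2"
definition "(p::quat) div q = p * inverse q"

instance
proof
  fix p q :: quat and a :: real
  show scl: "(a *\<^sub>R p) * q = a *\<^sub>R (p * q)" and scr: "p * (a *\<^sub>R q) = a *\<^sub>R (p * q)" for p q :: quat and a
    by (simp_all add: quat_eq_iff times_quat_def algebra_simps)
  show "inverse p * p = 1" "p * inverse p = 1" if "p \<noteq> 0"
    using that by (simp_all add: inverse_quat_def scl scr mult_qcnj qcnj_mult_self)
  show "p div q = p * inverse q" by (rule divide_quat_def)
  show "inverse (0::quat) = 0" by (simp add: inverse_quat_def quat_eq_iff)
  have "(norm (p * q))\<^sup>2 = (norm p * norm q)\<^sup>2"
    unfolding power_mult_distrib norm_quat_power2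
    by (simp add: times_quat_def power2_eq_square algebra_simps)
  then show "norm (p * q) = norm p * norm q"
    by (metis mult_nonneg_nonneg norm_ge_zero power2_eq_imp_eq)
qed

end

lemma of_real_quat: "of_real a = Quat a 0 0 0"
  by (simp add: of_real_def quat_eq_iff)

instantiation quat :: euclidean_space
begin

definition "Basis = {Quat 1 0 0 0, Quat 0 1 0 0, Quat 0 0 1 0, Quat 0 0 0 1}"

instance
proof
  fix u v :: quat
  show "(Basis :: quat set) \<noteq> {}" "finite (Basis :: quat set)"
    by (simp_all add: Basis_quat_def)
  show "u \<bullet> v = (if u = v then 1 else 0)" if "u \<in> Basis" "v \<in> Basis"
    using that unfolding Basis_quat_def by (elim insertE emptyE) (simp_all add: inner_quat_def)
  show "(\<forall>w\<in>Basis. u \<bullet> w = 0) \<longleftrightarrow> u = 0"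
    by (simp add: Basis_quat_def inner_quat_def quat_eq_iff[of u 0])
qed

end

definition imag_units :: "quat set" where
  "imag_units = {q. q\<^sup>2 = -1}"

definition qpt :: "quat \<Rightarrow> real \<Rightarrow> real \<Rightarrow> quat" where
  "qpt I x y = of_real x + of_real y * I"

definition qcis :: "quat \<Rightarrow> real \<Rightarrow> quat" where
  "qcis I \<theta> = of_real (cos \<theta>) + I * of_real (sin \<theta>)"

definition slice_dx :: "quat \<Rightarrow> (quat \<Rightarrow> quat) \<Rightarrow> real \<Rightarrow> real \<Rightarrow> quat" where
  "slice_dx I f x y = vector_derivative (\<lambda>t. f (qpt I t y)) (at x)"

definition slice_dy :: "quat \<Rightarrow> (quat \<Rightarrow> quat) \<Rightarrow> real \<Rightarrow> real \<Rightarrow> quat" where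
  "slice_dy I f x y = vector_derivative (\<lambda>t. f (qpt I x t)) (at y)"

definition slice_regular_on :: "(quat \<Rightarrow> quat) \<Rightarrow> quat set \<Rightarrow> bool" where
  "slice_regular_on f \<Omega> \<longleftrightarrow> open \<Omega> \<and> connected \<Omega> \<and>
    (\<forall>I\<in>imag_units.
      (\<forall>x y. qpt I x y \<in> \<Omega> \<longrightarrow>
        (\<lambda>t. f (qpt I t y)) differentiable (at x) \<and>
        (\<lambda>t. f (qpt I x t)) differentiable (at y) \<and>
        (1/2) *\<^sub>R (slice_dx I f x y + I * slice_dy I f x y) = 0) \<and>
      continuous_on {(x, y). qpt I x y \<in> \<Omega>} (\<lambda>(x, y). slice_dx I f x y) \<and>
      continuous_on {(x, y). qpt I x y \<in> \<Omega>} (\<lambda>(x, y). slice_dy I f x y))"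

text \<open>For slice regular functions the value below does not depend on the representation
  \<open>q = x + y I\<close>, even at real points, where \<open>I\<close> is arbitrary.\<close>

definition slice_deriv :: "(quat \<Rightarrow> quat) \<Rightarrow> quat \<Rightarrow> quat" where
  "slice_deriv f q = (THE d. \<exists>I\<in>imag_units. \<exists>x y. q = qpt I x y \<and>
     d = (1/2) *\<^sub>R (slice_dx I f x y - I * slice_dy I f x y))"

text \<open>The operations below are defined for slice regular functions on the unit ball, through
  the (unique) coefficients of their power series there.  Only values on the unit ball matter.\<close>

definition slice_coeff :: "(quat \<Rightarrow> quat) \<Rightarrow> nat \<Rightarrow> quat" where
  "slice_coeff f = (THE a. \<forall>q\<in>ball 0 1. (\<lambda>n. q ^ n * a n) sums f q)"

definition reg_prod :: "(quat \<Rightarrow> quat) \<Rightarrow> (quat \<Rightarrow> quat) \<Rightarrow> quat \<Rightarrow> quat" where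
  "reg_prod f g q = (\<Sum>n. q ^ n * (\<Sum>k\<le>n. slice_coeff f k * slice_coeff g (n - k)))"

definition reg_conj :: "(quat \<Rightarrow> quat) \<Rightarrow> quat \<Rightarrow> quat" where
  "reg_conj f q = (\<Sum>n. q ^ n * qcnj (slice_coeff f n))"

definition reg_symm :: "(quat \<Rightarrow> quat) \<Rightarrow> quat \<Rightarrow> quat" where
  "reg_symm f = reg_prod f (reg_conj f)"

definition reg_recip :: "(quat \<Rightarrow> quat) \<Rightarrow> quat \<Rightarrow> quat" where
  "reg_recip f q = inverse (reg_symm f q) * reg_conj f q"

text \<open>Functions on the unit ball are total functions whose values off the ball are irrelevant.\<close>

definition bounded_class :: "real \<Rightarrow> (quat \<Rightarrow> quat) set" where
  "bounded_class \<alpha> = {f. f ` ball 0 1 \<subseteq> ball 0 1 \<and> slice_regular_on f (ball 0 1) \<and>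
     f 0 = 0 \<and> norm (slice_deriv f 0) = \<alpha>}"

text \<open>The bound \<open>r \<le> 1\<close> keeps \<open>ball 0 r\<close> inside the domain of \<open>f\<close>.\<close>

definition inj_radius :: "(quat \<Rightarrow> quat) \<Rightarrow> real" where
  "inj_radius f = Sup {r. 0 \<le> r \<and> r \<le> 1 \<and> inj_on f (ball 0 r)}"

definition class_inj_radius :: "real \<Rightarrow> real" where
  "class_inj_radius \<alpha> = (INF f\<in>bounded_class \<alpha>. inj_radius f)"

definition cover_radius :: "real \<Rightarrow> real \<Rightarrow> real" where
  "cover_radius \<alpha> r = r * ((\<alpha> - r) / (1 - \<alpha> * r))"

text \<open>The leading factor \<open>q\<close> and the constant \<open>v\<close> on the right may be multiplied pointwise:
  \<open>q\<close> has real coefficients, and \<open>v\<close> is a right constant, so both agree with the regular product.\<close>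

definition extremal_form :: "real \<Rightarrow> (quat \<Rightarrow> quat) \<Rightarrow> bool" where
  "extremal_form \<alpha> f \<longleftrightarrow> (\<exists>I\<in>imag_units. \<exists>\<theta>::real. \<exists>v\<in>frontier (ball 0 1). \<forall>q\<in>ball 0 1.
     f q = q * reg_prod (reg_recip (\<lambda>p. 1 - p * of_real \<alpha> * qcis I (- \<theta>)))
                        (\<lambda>p. p - of_real \<alpha> * qcis I \<theta>) q * v)"

definition largest_centred_ball :: "quat set \<Rightarrow> real \<Rightarrow> bool" where
  "largest_centred_ball S R \<longleftrightarrow> ball 0 R \<subseteq> S \<and> (\<forall>\<rho>. ball 0 \<rho> \<subseteq> S \<longrightarrow> ball (0::quat) \<rho> \<subseteq> ball 0 R)"

end

theory Submission
  imports Defs "HOL-Complex_Analysis.Complex_Analysis"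
begin

text \<open>
  The proof follows the classical argument of Landau. Write \<open>mob \<alpha> x = (\<alpha> - x) / (1 - \<alpha> x)\<close>; its
  fixed point in the unit interval is \<open>landau_radius \<alpha> = \<alpha> / (1 + sqrt (1 - \<alpha>\<^sup>2))\<close>. Two inequalities
  for a member \<open>f\<close> of the class carry everything:

  \<^item> growth: \<open>norm q * mob \<alpha> (norm q) \<le> norm (f q)\<close>, and equality at one \<open>q\<close> with
    \<open>0 < norm q < \<alpha>\<close> forces \<open>f\<close> to be extremal (\<open>growth\<close>, \<open>growth_equality\<close>);
  \<^item> double values: if \<open>q1 \<noteq> q2\<close> and \<open>f q1 = f q2\<close>, then \<open>norm (f q1) \<le> norm q1 * norm q2\<close>
    (\<open>double_value_bound\<close>).

  Together they give \<open>mob \<alpha> (norm q1) \<le> norm q2\<close> for points with a common value. This is impossible if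
  both norms are below \<open>landau_radius \<alpha>\<close>, since \<open>mob \<alpha>\<close> is decreasing. So \<open>f\<close> is injective there, and
  by compactness the injectivity radius equals \<open>landau_radius \<alpha>\<close> only if the growth estimate is an
  equality somewhere. The covering statements follow from the growth estimate on spheres and
  invariance of domain. Sharpness is seen on the diameter on which an extremal function is, up to
  rotations, \<open>x \<mapsto> - x * mob \<alpha> x\<close>, a map invariant under the involution \<open>mob \<alpha>\<close>.

  Growth is a one-variable statement: on a slice, the projection of \<open>f\<close> to the slice is holomorphic, and
  Schwarz--Pick applies. The double value bound is also of this kind if both points lie on one slice.
  Otherwise one may take the common value to be a real \<open>c \<ge> 0\<close> and use the symmetrizations of
  \<open>f - c\<close> and \<open>1 - c f\<close>, which are holomorphic functions of one complex variable. The modulus of a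
  symmetrization is the product of the maximum and the minimum of the modulus of the function on
  the sphere \<open>x + y S\<close> (\<open>symm_value_extremes\<close>), so the inequality \<open>\<bar>f - c\<bar> \<le> \<bar>1 - c f\<bar>\<close> passes to the
  symmetrizations. Their quotient is bounded by 1, vanishes at two pairs of conjugate points, and
  has the value \<open>c\<^sup>2\<close> at 0; dividing by Blaschke factors gives \<open>c\<^sup>2 \<le> (norm q1 * norm q2)\<^sup>2\<close>.

  Regular products and reciprocals occur only in the description of the extremal functions. They are
  eliminated in favour of explicit power series (\<open>extremal_form_iff\<close>).
\<close>

section \<open>Bounded holomorphic functions on the unit disc\<close>

lemma holomorphic_on_disc_compose:
  assumes "g holomorphic_on ball 0 1" "h holomorphic_on ball 0 1"
    and "\<And>z. cmod z < 1 \<Longrightarrow> cmod (g z) < 1"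
  shows "(\<lambda>z. h (g z)) holomorphic_on ball 0 1"
  using holomorphic_on_compose_gen[OF assms(1,2)] assms(3) by (auto simp: o_def image_subset_iff)

lemma disc_one_minus_mult_nonzero:
  assumes "cmod a < 1" "cmod b < 1"
  shows "1 - a * b \<noteq> 0"
proof -
  have "cmod (a * b) < 1 * 1"
    unfolding norm_mult using assms by (intro mult_strict_mono') auto
  then show ?thesis by auto
qed

text \<open>A zero \<open>a\<close> of a function bounded by 1 can be divided out by the Blaschke factor
  \<open>(z - a) / (1 - cnj a * z)\<close> without losing the bound: a disc automorphism moves \<open>a\<close> to 0, and
  there the Schwarz lemma applies. The lemma needs values of modulus strictly below 1, hence the
  scaling by \<open>t < 1\<close> in the proof.\<close>

lemma disc_zero_factor:
  assumes holh: "h holomorphic_on ball 0 1" and bd: "\<And>z. cmod z < 1 \<Longrightarrow> cmod (h z) \<le> 1"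
    and a: "cmod a < 1" and ha: "h a = 0"
  obtains k where "k holomorphic_on ball 0 1" "\<And>z. cmod z < 1 \<Longrightarrow> cmod (k z) \<le> 1"
    "\<And>z. cmod z < 1 \<Longrightarrow> h z = Moebius_function 0 a z * k z"
proof -
  define \<phi> where "\<phi> = Moebius_function 0 (-a)"
  define \<psi> where "\<psi> = Moebius_function 0 a"
  have hol\<phi>: "\<phi> holomorphic_on ball 0 1" and hol\<psi>: "\<psi> holomorphic_on ball 0 1"
    using a by (auto simp: \<phi>_def \<psi>_def intro!: Moebius_function_holomorphic)
  have n\<phi>: "cmod (\<phi> z) < 1" and n\<psi>: "cmod (\<psi> z) < 1" if "cmod z < 1" for z
    using that a by (auto simp: \<phi>_def \<psi>_def intro!: Moebius_function_norm_lt_1)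
  have inv: "\<phi> (\<psi> z) = z" if "cmod z < 1" for z
    unfolding \<phi>_def \<psi>_def using that a by (intro Moebius_function_compose) auto
  define g where "g z = h (\<phi> z)" for z
  have holg: "g holomorphic_on ball 0 1"
    unfolding g_def by (rule holomorphic_on_disc_compose[OF hol\<phi> holh n\<phi>])
  have g0: "g 0 = 0"
    using ha by (simp add: g_def \<phi>_def Moebius_function_of_zero)
  obtain k where holk: "k holomorphic_on ball 0 1" and gk: "\<And>z. cmod z < 1 \<Longrightarrow> g z = z * k z"
    and dk: "deriv g 0 = k 0"
    using Schwarz3[OF holg g0] by blast
  have scaled: "t * cmod (k z) \<le> 1" if t: "0 < t" "t < 1" and z: "cmod z < 1" for t z
  proof -
    define G where "G z = of_real t * g z" for z
    have holG: "G holomorphic_on ball 0 1" unfolding G_def by (intro holomorphic_intros holg)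
    have G0: "G 0 = 0" by (simp add: G_def g0)
    have Gb: "cmod (G w) < 1" if "cmod w < 1" for w
    proof -
      have "cmod (G w) \<le> t * 1"
        unfolding G_def norm_mult using t bd[OF n\<phi>[OF that]]
        by (intro mult_mono) (auto simp: g_def)
      then show ?thesis using t by simp
    qed
    have dG: "deriv G 0 = of_real t * k 0"
    proof -
      have "g field_differentiable at 0"
        using holg by (simp add: holomorphic_on_imp_differentiable_at)
      then show ?thesis unfolding G_def using dk by (simp add: deriv_cmult)
    qed
    show ?thesis
    proof (cases "z = 0")
      case True
      then show ?thesis
        using Schwarz_Lemma(2)[OF holG G0 Gb, of 0] dG t by (simp add: norm_mult)
    next
      case False
      have "t * (cmod z * cmod (k z)) \<le> cmod z"
        using Schwarz_Lemma(1)[OF holG G0 Gb z] t gk[OF z] by (simp add: G_def norm_mult)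
      then have "cmod z * (t * cmod (k z)) \<le> cmod z * 1" by (simp add: algebra_simps)
      then show ?thesis using False by (simp only: mult_le_cancel_left) auto
    qed
  qed
  have kb: "cmod (k z) \<le> 1" if z: "cmod z < 1" for z
  proof (rule ccontr)
    assume "\<not> ?thesis"
    then have c: "cmod (k z) > 1" by simp
    then obtain t where t: "inverse (cmod (k z)) < t" "t < 1"
      using dense[of "inverse (cmod (k z))" 1] by (auto simp: inverse_less_1_iff)
    have kz: "k z \<noteq> 0" using c by auto
    have "0 < t" using t c by (smt (verit) inverse_nonnegative_iff_nonnegative norm_ge_zero)
    moreover have "t * cmod (k z) > 1"
      using t c pos_divide_less_eq[of "cmod (k z)" 1 t] kz by (simp add: inverse_eq_divide)
    ultimately show False using scaled[of t z] t z by simp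
  qed
  show ?thesis
  proof
    show "(\<lambda>z. k (\<psi> z)) holomorphic_on ball 0 1"
      by (rule holomorphic_on_disc_compose[OF hol\<psi> holk n\<psi>])
    show "cmod (k (\<psi> z)) \<le> 1" if "cmod z < 1" for z
      using kb n\<psi> that by blast
    show "h z = Moebius_function 0 a z * k (\<psi> z)" if "cmod z < 1" for z
      using gk[OF n\<psi>[OF that]] inv[OF that] by (simp add: g_def \<psi>_def)
  qed
qed

lemma disc_zeros_bound:
  assumes "finite Z" and "h holomorphic_on ball 0 1"
    and "\<And>z. cmod z < 1 \<Longrightarrow> cmod (h z) \<le> 1"
    and "\<And>a. a \<in> Z \<Longrightarrow> cmod a < 1 \<and> h a = 0"
  shows "cmod (h 0) \<le> (\<Prod>a\<in>Z. cmod a)"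
  using assms
proof (induction Z arbitrary: h rule: finite_induct)
  case empty
  then show ?case by simp
next
  case (insert a Z)
  have a: "cmod a < 1" "h a = 0" using insert.prems by auto
  obtain k where k: "k holomorphic_on ball 0 1" "\<And>z. cmod z < 1 \<Longrightarrow> cmod (k z) \<le> 1"
    and hk: "\<And>z. cmod z < 1 \<Longrightarrow> h z = Moebius_function 0 a z * k z"
    using disc_zero_factor[OF insert.prems(1,2) a] by blast
  have "cmod b < 1 \<and> k b = 0" if b: "b \<in> Z" for b
  proof -
    have b1: "cmod b < 1" "h b = 0" "b \<noteq> a" using insert.prems(3) insert.hyps b by auto
    have "1 - cnj a * b \<noteq> 0" using disc_one_minus_mult_nonzero[of "cnj a" b] a b1 by simp
    then have "Moebius_function 0 a b \<noteq> 0" using b1 by (simp add: Moebius_function_simple)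
    then show ?thesis using hk[of b] b1 by simp
  qed
  then have "cmod (k 0) \<le> (\<Prod>a\<in>Z. cmod a)" using insert.IH[OF k] by blast
  then have "cmod a * cmod (k 0) \<le> cmod a * (\<Prod>a\<in>Z. cmod a)" by (simp add: mult_left_mono)
  then show ?case
    using hk[of 0] insert.hyps by (simp add: norm_mult Moebius_function_of_zero)
qed

lemma cmod_one_minus_le:
  assumes "cmod w \<le> 1" "0 \<le> c" "c \<le> 1"
  shows "cmod (w - of_real c) \<le> cmod (1 - of_real c * w)"
proof -
  have "(cmod (1 - of_real c * w))\<^sup>2 - (cmod (w - of_real c))\<^sup>2 = (1 - c\<^sup>2) * (1 - (cmod w)\<^sup>2)"
    unfolding cmod_power2 by (simp add: power2_eq_square algebra_simps)
  moreover have "(1 - c\<^sup>2) * (1 - (cmod w)\<^sup>2) \<ge> 0"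
    using assms by (intro mult_nonneg_nonneg) (auto simp: power_le_one)
  ultimately show ?thesis by (metis diff_ge_0_iff_ge norm_ge_zero power2_le_imp_le)
qed

text \<open>The Moebius map on the radius. It exchanges 0 and \<open>\<alpha>\<close>, and \<open>mob \<alpha> \<bar>z\<bar>\<close> is the
  Schwarz--Pick lower bound for \<open>\<bar>H z\<bar>\<close> when \<open>H\<close> maps the disc into itself and \<open>\<bar>H 0\<bar> = \<alpha>\<close>.\<close>

definition mob :: "real \<Rightarrow> real \<Rightarrow> real" where
  "mob \<alpha> x = (\<alpha> - x) / (1 - \<alpha> * x)"

lemma mob_denominator_pos:
  fixes \<alpha> x :: real
  assumes "0 < \<alpha>" "\<alpha> < 1" "\<bar>x\<bar> < 1"
  shows "0 < 1 - \<alpha> * x"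
proof -
  have "\<bar>\<alpha> * x\<bar> < 1 * 1" unfolding abs_mult using assms by (intro mult_strict_mono') auto
  then show ?thesis by simp
qed

lemma mob_strict_antimono:
  assumes "0 < \<alpha>" "\<alpha> < 1" "0 \<le> x" "x < y" "y < 1"
  shows "mob \<alpha> y < mob \<alpha> x"
proof -
  have "(\<alpha> - x) * (1 - \<alpha> * y) - (\<alpha> - y) * (1 - \<alpha> * x) = (y - x) * (1 - \<alpha>\<^sup>2)"
    by (simp add: power2_eq_square algebra_simps)
  moreover have "(y - x) * (1 - \<alpha>\<^sup>2) > 0"
    using assms by (intro mult_pos_pos) (auto simp: power_less_one_iff abs_square_less_1)
  ultimately show ?thesis
    unfolding mob_def using mob_denominator_pos[of \<alpha> x] mob_denominator_pos[of \<alpha> y] assms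
    by (simp add: frac_less_eq divide_less_eq less_divide_eq field_simps)
qed

text \<open>The classical growth estimate, with its case of equality. Divide \<open>F\<close> by \<open>z\<close> and move the
  value \<open>\<alpha>\<close> of the quotient \<open>H\<close> at 0 to 0 by a Moebius map; the Schwarz lemma for the resulting
  \<open>M\<close> gives the bound, and equality at one point makes \<open>M\<close> a rotation.\<close>

lemma Landau_growth:
  fixes F :: "complex \<Rightarrow> complex"
  assumes holF: "F holomorphic_on ball 0 1" and F0: "F 0 = 0"
    and Fb: "\<And>z. cmod z < 1 \<Longrightarrow> cmod (F z) < 1"
    and dF: "deriv F 0 = of_real \<alpha>" and \<alpha>: "0 < \<alpha>" "\<alpha> < 1"
  shows "cmod z < 1 \<Longrightarrow> cmod z * ((\<alpha> - cmod z) / (1 - \<alpha> * cmod z)) \<le> cmod (F z)"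
    and "\<lbrakk>z \<noteq> 0; cmod z < \<alpha>; cmod (F z) = cmod z * ((\<alpha> - cmod z) / (1 - \<alpha> * cmod z))\<rbrakk> \<Longrightarrow>
      \<exists>\<mu>. cmod \<mu> = 1 \<and>
        (\<forall>z. cmod z < 1 \<longrightarrow> F z = z * ((of_real \<alpha> - \<mu> * z) / (1 - of_real \<alpha> * \<mu> * z)))"
proof -
  obtain H where holH: "H holomorphic_on ball 0 1" and FH: "\<And>z. cmod z < 1 \<Longrightarrow> F z = z * H z"
    and H0: "H 0 = of_real \<alpha>"
    using Schwarz3[OF holF F0] dF by metis
  have Hb: "cmod (H z) < 1" if z: "cmod z < 1" for z
  proof (cases "z = 0")
    case True
    then show ?thesis using H0 \<alpha> by simp
  next
    case False
    have le: "cmod (F z) \<le> cmod z" using Schwarz_Lemma(1)[OF holF F0 Fb z] .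
    have "cmod (F z) \<noteq> cmod z"
    proof
      assume "cmod (F z) = cmod z"
      then obtain c where c: "\<And>z. cmod z < 1 \<Longrightarrow> F z = c * z" "cmod c = 1"
        using Schwarz_Lemma(3)[OF holF F0 Fb z] z False by blast
      define z0 where "z0 = (1/2 :: complex)"
      have "cmod z0 < 1" by (simp add: z0_def)
      have "(F has_field_derivative c) (at 0)"
      proof (rule has_field_derivative_transform_within_open)
        show "((\<lambda>z. c * z) has_field_derivative c) (at 0)"
          by (auto intro!: derivative_eq_intros)
        show "open (ball 0 1 :: complex set)" by simp
      qed (auto simp: c)
      then have "c = of_real \<alpha>" using dF DERIV_imp_deriv by blast
      then show False using c \<alpha> by simp
    qed
    then have "cmod z * cmod (H z) < cmod z * 1" using le FH[OF z] by (simp add: norm_mult)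
    then show ?thesis using False by (simp only: mult_less_cancel_left) auto
  qed
  have den: "1 - of_real \<alpha> * w \<noteq> 0" if "cmod w < 1" for w :: complex
    using disc_one_minus_mult_nonzero[of "of_real \<alpha>" w] that \<alpha> by simp
  define M where "M z = - Moebius_function 0 (of_real \<alpha>) (H z)" for z
  have M_eq: "M z = (of_real \<alpha> - H z) / (1 - of_real \<alpha> * H z)" for z
    unfolding M_def Moebius_function_simple by (simp add: minus_divide_left)
  have holM: "M holomorphic_on ball 0 1"
  proof -
    have "Moebius_function 0 (of_real \<alpha>) holomorphic_on ball 0 1"
      using \<alpha> by (intro Moebius_function_holomorphic) auto
    from holomorphic_on_disc_compose[OF holH this Hb]
    have "(\<lambda>z. Moebius_function 0 (of_real \<alpha>) (H z)) holomorphic_on ball 0 1" .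
    then show ?thesis unfolding M_def by (intro holomorphic_intros)
  qed
  have M0: "M 0 = 0" by (simp add: M_eq H0)
  have Mb: "cmod (M z) < 1" if "cmod z < 1" for z
    unfolding M_def norm_minus_cancel using Hb[OF that] \<alpha>
    by (intro Moebius_function_norm_lt_1) auto
  have HM: "H z = (of_real \<alpha> - M z) / (1 - of_real \<alpha> * M z)" if z: "cmod z < 1" for z
    using Moebius_function_compose[of "-of_real \<alpha>" "of_real \<alpha>" "H z"] \<alpha> Hb[OF z]
    unfolding M_def by (simp add: Moebius_function_simple[of "- of_real \<alpha>"] add.commute)
  have lower: "(\<alpha> - cmod w) / (1 - \<alpha> * cmod w) \<le>
      cmod ((of_real \<alpha> - w) / (1 - of_real \<alpha> * w))" if w: "cmod w < 1" for w :: complex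
  proof (cases "cmod w \<le> \<alpha>")
    case False
    then have "(\<alpha> - cmod w) / (1 - \<alpha> * cmod w) \<le> 0"
      using \<alpha> w mult_strict_mono[of \<alpha> 1 "cmod w" 1]
      by (intro divide_nonpos_nonneg) auto
    then show ?thesis by (smt (verit) norm_ge_zero)
  next
    case True
    define x where "x = Re w"
    define s where "s = cmod w"
    have s: "0 \<le> s" "s \<le> \<alpha>" "s < 1" "x \<le> s"
      using True w complex_Re_le_cmod by (auto simp: s_def x_def)
    have as: "\<alpha> * s < 1" using \<alpha> s mult_strict_mono[of \<alpha> 1 s 1] by auto
    have n1: "(cmod (of_real \<alpha> - w))\<^sup>2 = \<alpha>\<^sup>2 + s\<^sup>2 - 2 * \<alpha> * x"
      unfolding s_def x_def cmod_power2 by (simp add: power2_eq_square algebra_simps)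
    have n2: "(cmod (1 - of_real \<alpha> * w))\<^sup>2 = 1 + \<alpha>\<^sup>2 * s\<^sup>2 - 2 * \<alpha> * x"
      unfolding s_def x_def cmod_power2 by (simp add: power2_eq_square algebra_simps)
    have p: "0 < cmod (1 - of_real \<alpha> * w)" using den w by auto
    have "((\<alpha> - s) * cmod (1 - of_real \<alpha> * w))\<^sup>2 \<le> (cmod (of_real \<alpha> - w) * (1 - \<alpha> * s))\<^sup>2"
    proof -
      have "(\<alpha>\<^sup>2 + s\<^sup>2 - 2 * \<alpha> * x) * (1 - \<alpha> * s)\<^sup>2 - (\<alpha> - s)\<^sup>2 * (1 + \<alpha>\<^sup>2 * s\<^sup>2 - 2 * \<alpha> * x)
        = 2 * \<alpha> * (s - x) * ((1 - \<alpha>\<^sup>2) * (1 - s\<^sup>2))"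
        by (simp add: power2_eq_square algebra_simps)
      moreover have "\<dots> \<ge> 0" using \<alpha> s by (intro mult_nonneg_nonneg) (auto simp: power_le_one)
      ultimately show ?thesis by (simp add: power_mult_distrib n1 n2)
    qed
    then have "(\<alpha> - s) * cmod (1 - of_real \<alpha> * w) \<le> cmod (of_real \<alpha> - w) * (1 - \<alpha> * s)"
      using as by (intro power2_le_imp_le[of "(\<alpha> - s) * cmod (1 - of_real \<alpha> * w)"]) auto
    then show ?thesis using p as by (simp add: norm_divide s_def[symmetric] field_simps)
  qed
  note mono = mob_strict_antimono[OF \<alpha>, unfolded mob_def]
  have Hlow: "(\<alpha> - cmod (M z)) / (1 - \<alpha> * cmod (M z)) \<le> cmod (H z)" if z: "cmod z < 1" for z
    using lower[OF Mb[OF z]] HM[OF z] by simp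
  show "cmod z * ((\<alpha> - cmod z) / (1 - \<alpha> * cmod z)) \<le> cmod (F z)" if z: "cmod z < 1"
  proof -
    have "cmod (M z) \<le> cmod z" using Schwarz_Lemma(1)[OF holM M0 Mb z] .
    then have "(\<alpha> - cmod z) / (1 - \<alpha> * cmod z) \<le> (\<alpha> - cmod (M z)) / (1 - \<alpha> * cmod (M z))"
      using mono[of "cmod (M z)" "cmod z"] z by (cases "cmod (M z) = cmod z") auto
    then have "(\<alpha> - cmod z) / (1 - \<alpha> * cmod z) \<le> cmod (H z)" using Hlow[OF z] by simp
    then show ?thesis unfolding FH[OF z] norm_mult by (rule mult_left_mono) simp
  qed
  show "\<exists>\<mu>. cmod \<mu> = 1 \<and>
        (\<forall>z. cmod z < 1 \<longrightarrow> F z = z * ((of_real \<alpha> - \<mu> * z) / (1 - of_real \<alpha> * \<mu> * z)))"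
    if z: "z \<noteq> 0" "cmod z < \<alpha>" and eq: "cmod (F z) = cmod z * ((\<alpha> - cmod z) / (1 - \<alpha> * cmod z))"
  proof -
    have z1: "cmod z < 1" using z \<alpha> by simp
    have Hz: "cmod (H z) = (\<alpha> - cmod z) / (1 - \<alpha> * cmod z)"
      using eq FH[OF z1] z by (simp only: norm_mult mult_cancel_left) auto
    have "cmod (M z) \<le> cmod z" using Schwarz_Lemma(1)[OF holM M0 Mb z1] .
    moreover have "\<not> cmod (M z) < cmod z"
      using mono[of "cmod (M z)" "cmod z"] Hlow[OF z1] Hz z1 by auto
    ultimately have "cmod (M z) = cmod z" by simp
    then obtain \<mu> where \<mu>: "\<And>z. cmod z < 1 \<Longrightarrow> M z = \<mu> * z" "cmod \<mu> = 1"
      using Schwarz_Lemma(3)[OF holM M0 Mb z1] z1 z by blast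
    show ?thesis
      by (rule exI[of _ \<mu>]) (use \<mu> HM FH in \<open>auto simp: mult.assoc\<close>)
  qed
qed

section \<open>Slices of the quaternions\<close>

lemma imag_units_iff:
  "I \<in> imag_units \<longleftrightarrow> qre I = 0 \<and> (qi I)\<^sup>2 + (qj I)\<^sup>2 + (qk I)\<^sup>2 = 1"
proof -
  have sq: "I \<in> imag_units \<longleftrightarrow> (qre I)\<^sup>2 - (qi I)\<^sup>2 - (qj I)\<^sup>2 - (qk I)\<^sup>2 = -1 \<and>
      qre I * qi I = 0 \<and> qre I * qj I = 0 \<and> qre I * qk I = 0"
    by (auto simp: imag_units_def quat_eq_iff power2_eq_square times_quat_def algebra_simps)
  show ?thesis
  proof (cases "qre I = 0")
    case False
    have "(qre I)\<^sup>2 \<noteq> -1" by (metis not_one_le_zero neg_0_le_iff_le zero_le_power2)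
    then show ?thesis using sq False by auto
  qed (auto simp: sq)
qed

lemma imag_units_mult_self: "I \<in> imag_units \<Longrightarrow> I * I = -1"
  by (simp add: imag_units_def power2_eq_square)

lemma imag_units_uminus: "I \<in> imag_units \<Longrightarrow> - I \<in> imag_units"
  by (simp add: imag_units_iff)

lemma norm_imag_units: "I \<in> imag_units \<Longrightarrow> norm I = 1"
  by (simp add: imag_units_iff norm_quat_def)

lemma imag_units_nonempty: "Quat 0 1 0 0 \<in> imag_units"
  by (simp add: imag_units_iff)

lemma imag_units_anticommuting:
  assumes "I \<in> imag_units"
  obtains J where "J \<in> imag_units" "I * J = - (J * I)"
proof (cases "qi I = 0 \<and> qj I = 0")
  case True
  then show ?thesis
    using assms by (intro that[of "Quat 0 1 0 0"]) (auto simp: imag_units_iff quat_eq_iff times_quat_def)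
next
  case False
  define s where "s = sqrt ((qi I)\<^sup>2 + (qj I)\<^sup>2)"
  have s: "s > 0" "s\<^sup>2 = (qi I)\<^sup>2 + (qj I)\<^sup>2"
    using False by (auto simp: s_def sum_power2_gt_zero_iff)
  show ?thesis
  proof (rule that[of "Quat 0 (- qj I / s) (qi I / s) 0"])
    show "Quat 0 (- qj I / s) (qi I / s) 0 \<in> imag_units"
    proof -
      have "(qj I)\<^sup>2 + (qi I)\<^sup>2 = s\<^sup>2" using s by simp
      then show ?thesis
        using s(1) by (simp add: imag_units_iff power_divide add_divide_distrib[symmetric])
    qed
    show "I * Quat 0 (- qj I / s) (qi I / s) 0 = - (Quat 0 (- qj I / s) (qi I / s) 0 * I)"
      using assms s by (simp add: imag_units_iff quat_eq_iff times_quat_def)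
  qed
qed

text \<open>The embedding \<open>x + \<i>y \<mapsto> x + yI\<close> of the complex numbers as the slice of \<open>I\<close>. For
  \<open>I \<in> imag_units\<close> it is an isometric ring homomorphism.\<close>

definition slice_of :: "quat \<Rightarrow> complex \<Rightarrow> quat" where
  "slice_of I z = qpt I (Re z) (Im z)"

lemma slice_of_alt: "slice_of I z = Re z *\<^sub>R 1 + Im z *\<^sub>R I"
  by (simp add: slice_of_def qpt_def of_real_def)

lemma qpt_eq_slice_of: "qpt I x y = slice_of I (Complex x y)"
  by (simp add: slice_of_def)

lemma slice_of_mult: "I \<in> imag_units \<Longrightarrow> slice_of I (z * w) = slice_of I z * slice_of I w"
  by (simp add: slice_of_alt algebra_simps imag_units_mult_self)

lemma slice_of_0 [simp]: "slice_of I 0 = 0" and slice_of_1 [simp]: "slice_of I 1 = 1"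
  and slice_of_of_real [simp]: "slice_of I (of_real x) = of_real x"
  by (simp_all add: slice_of_alt of_real_def)

lemma slice_of_minus: "slice_of I (- z) = - slice_of I z"
  and slice_of_diff: "slice_of I (z - w) = slice_of I z - slice_of I w"
  by (simp_all add: slice_of_alt algebra_simps)

lemma slice_of_power: "I \<in> imag_units \<Longrightarrow> slice_of I (z ^ n) = slice_of I z ^ n"
  by (induction n) (simp_all add: slice_of_mult)

lemma norm_slice_of: "I \<in> imag_units \<Longrightarrow> norm (slice_of I z) = cmod z"
  by (simp add: slice_of_alt norm_quat_def cmod_def imag_units_iff power_mult_distrib
      add.assoc distrib_left[symmetric])

lemma norm_qcnj [simp]: "norm (qcnj q) = norm q"
  by (simp add: norm_quat_def)

lemma slice_of_inverse:
  assumes "I \<in> imag_units"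
  shows "slice_of I (inverse z) = inverse (slice_of I z)"
proof (cases "z = 0")
  case False
  then have "slice_of I z * slice_of I (inverse z) = 1"
    using assms by (simp flip: slice_of_mult)
  then show ?thesis by (rule inverse_unique[symmetric])
qed simp

lemma slice_of_uminus_cnj: "slice_of (- I) (cnj z) = slice_of I z"
  by (simp add: slice_of_alt)

lemma qcnj_slice_of: "I \<in> imag_units \<Longrightarrow> qcnj (slice_of I z) = slice_of I (cnj z)"
  by (simp add: slice_of_alt quat_eq_iff imag_units_iff)

lemma slice_of_eq_iff:
  assumes "I \<in> imag_units"
  shows "slice_of I z = slice_of I w \<longleftrightarrow> z = w"
  using norm_slice_of[OF assms, of "z - w"] by (auto simp: slice_of_diff)

lemma bounded_linear_slice_of: "bounded_linear (slice_of I)"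
  unfolding slice_of_alt
  by (intro bounded_linear_add bounded_linear_compose[OF bounded_linear_scaleR_left]
      bounded_linear_Re bounded_linear_Im)

lemma quat_in_slice:
  obtains I z where "I \<in> imag_units" "q = slice_of I z" "0 \<le> Im z"
proof (cases "qi q = 0 \<and> qj q = 0 \<and> qk q = 0")
  case True
  then show ?thesis
    by (intro that[of "Quat 0 1 0 0" "of_real (qre q)"]) (auto simp: imag_units_iff of_real_quat quat_eq_iff)
next
  case False
  define s where "s = sqrt ((qi q)\<^sup>2 + (qj q)\<^sup>2 + (qk q)\<^sup>2)"
  have s: "s > 0" "s\<^sup>2 = (qi q)\<^sup>2 + (qj q)\<^sup>2 + (qk q)\<^sup>2"
    using False by (auto simp: s_def add_nonneg_pos add_pos_nonneg)
  show ?thesis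
  proof (rule that[of "Quat 0 (qi q / s) (qj q / s) (qk q / s)" "Complex (qre q) s"])
    show "Quat 0 (qi q / s) (qj q / s) (qk q / s) \<in> imag_units"
      using s(1) by (simp add: imag_units_iff power_divide add_divide_distrib[symmetric] s(2)[symmetric])
  qed (use s in \<open>auto simp: slice_of_alt quat_eq_iff\<close>)
qed

text \<open>The orthogonal projection onto the slice of \<open>I\<close>, with the slice read as the complex
  numbers. It is complex linear for left multiplication by the slice, so composing a slice regular
  function with it gives an ordinary holomorphic function.\<close>

definition slice_part :: "quat \<Rightarrow> quat \<Rightarrow> complex" where
  "slice_part I p = Complex (inner p 1) (inner p I)"

lemma bounded_linear_slice_part: "bounded_linear (slice_part I)"
proof -
  have "slice_part I = (\<lambda>p. of_real (inner p 1) + \<i> * of_real (inner p I))"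
    by (rule ext) (simp add: slice_part_def complex_eq_iff)
  moreover have "bounded_linear (\<lambda>p. of_real (inner p 1) + \<i> * of_real (inner p I))"
    by (intro bounded_linear_add bounded_linear_const_mult
        bounded_linear_compose[OF bounded_linear_of_real] bounded_linear_inner_left)
  ultimately show ?thesis by simp
qed

lemma slice_part_0 [simp]: "slice_part I 0 = 0"
  by (simp add: slice_part_def complex_eq_iff)

lemma slice_part_mult:
  assumes "I \<in> imag_units"
  shows "slice_part I (slice_of I z * p) = z * slice_part I p"
proof -
  have 1: "inner (I * p) 1 = - inner p I" and 2: "inner (I * p) I = inner p 1"
  proof -
    have c: "qre I = 0" using assms by (simp add: imag_units_iff)
    show "inner (I * p) 1 = - inner p I"
      using assms by (simp add: inner_quat_def times_quat_def imag_units_iff algebra_simps)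
    have "inner (I * p) I = qre p * ((qi I)\<^sup>2 + (qj I)\<^sup>2 + (qk I)\<^sup>2)"
      using c by (simp add: inner_quat_def times_quat_def power2_eq_square algebra_simps)
    then show "inner (I * p) I = inner p 1"
      using assms by (simp add: inner_quat_def imag_units_iff)
  qed
  have "slice_of I z * p = Re z *\<^sub>R p + Im z *\<^sub>R (I * p)"
    by (simp add: slice_of_alt algebra_simps)
  then show ?thesis
    by (simp add: slice_part_def complex_eq_iff inner_add_left 1 2)
qed

lemma slice_part_of_real [simp]: "I \<in> imag_units \<Longrightarrow> slice_part I (of_real c) = of_real c"
  by (simp add: slice_part_def inner_quat_def of_real_quat complex_eq_iff imag_units_iff)

lemma slice_of_slice_part:
  assumes I: "I \<in> imag_units"
  shows "slice_of I (slice_part I p) = (1/2) *\<^sub>R (p - I * p * I)"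
proof -
  have c: "qre I = 0" "(qi I)\<^sup>2 = 1 - (qj I)\<^sup>2 - (qk I)\<^sup>2" using I by (auto simp: imag_units_iff)
  then have c2: "qi I * qi I = 1 - qj I * qj I - qk I * qk I" by (simp add: power2_eq_square)
  have c3: "qi I * (qi I * x) = x - qj I * (qj I * x) - qk I * (qk I * x)" for x
    using arg_cong[OF c2, of "\<lambda>t. t * x"] by (simp add: algebra_simps)
  show ?thesis
    unfolding slice_of_alt slice_part_def
    by (simp add: quat_eq_iff inner_quat_def times_quat_def c(1) c2 c3 algebra_simps)
qed

text \<open>As a left vector space over its slice of \<open>I\<close> the algebra has basis \<open>1, J\<close>; the second
  coordinate of \<open>p\<close> is the slice part of \<open>p * - J\<close>, since \<open>- J\<close> is the inverse of \<open>J\<close>.\<close>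

lemma slice_decomposition:
  assumes I: "I \<in> imag_units" and J: "J \<in> imag_units" and IJ: "I * J = - (J * I)"
  shows "slice_of I (slice_part I p) + slice_of I (slice_part I (p * - J)) * J = p"
proof -
  have II: "I * I = -1" and JJ: "J * J = -1" using I J by (simp_all add: imag_units_mult_self)
  have JIJ: "J * (I * J) = I" by (simp add: IJ mult.assoc[symmetric] JJ)
  show ?thesis
    using JJ JIJ unfolding slice_of_slice_part[OF I]
    by (simp add: algebra_simps) (simp add: mult.assoc flip: scaleR_add_left)
qed

lemma norm_slice_decomposition:
  assumes I: "I \<in> imag_units" and J: "J \<in> imag_units" and IJ: "I * J = - (J * I)"
  shows "(norm p)\<^sup>2 = (cmod (slice_part I p))\<^sup>2 + (cmod (slice_part I (p * - J)))\<^sup>2"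
proof -
  define s where "s = slice_of I (slice_part I p)"
  define t where "t = slice_of I (slice_part I (p * - J))"
  have orth: "inner s (t * J) = 0"
  proof -
    have c: "qre I = 0" "qre J = 0" using I J by (auto simp: imag_units_iff)
    have "qre (I * J) = 0" using arg_cong[OF IJ, of qre] c by (simp add: times_quat_def algebra_simps)
    then have o: "qi I * qi J + qj I * qj J + qk I * qk J = 0" using c by (simp add: times_quat_def)
    have "inner (slice_of I z) (slice_of I w * J) =
       (Re z * Im w * -1 + Im z * Re w) * (qi I * qi J + qj I * qj J + qk I * qk J)" for z w
      by (simp add: slice_of_alt inner_quat_def times_quat_def c algebra_simps)
    then show ?thesis using o by (simp add: s_def t_def)
  qed
  have "p = s + t * J" using slice_decomposition[OF assms] by (simp add: s_def t_def)
  then have "(norm p)\<^sup>2 = (norm s)\<^sup>2 + (norm (t * J))\<^sup>2"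
    using orth by (simp add: norm_add_Pythagorean orthogonal_def)
  then show ?thesis by (simp add: s_def t_def norm_mult norm_imag_units I J norm_slice_of)
qed

lemma cmod_slice_part_le:
  assumes I: "I \<in> imag_units"
  shows "cmod (slice_part I p) \<le> norm p"
proof -
  obtain J where "J \<in> imag_units" "I * J = - (J * I)" using imag_units_anticommuting[OF I] by blast
  then have "(cmod (slice_part I p))\<^sup>2 \<le> (norm p)\<^sup>2"
    unfolding norm_slice_decomposition[OF I \<open>J \<in> imag_units\<close> \<open>I * J = - (J * I)\<close>] by simp
  then show ?thesis by (rule power2_le_imp_le) simp
qed

section \<open>Power series of slice regular functions\<close>

text \<open>\<open>f\<close> has on the unit ball the power series with coefficients \<open>a\<close> on the right.\<close>

definition quat_powser :: "(nat \<Rightarrow> quat) \<Rightarrow> (quat \<Rightarrow> quat) \<Rightarrow> bool" where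
  "quat_powser a f \<longleftrightarrow> (\<forall>q\<in>ball 0 1. (\<lambda>n. q ^ n * a n) sums f q)"

lemma quat_powserD: "quat_powser a f \<Longrightarrow> norm q < 1 \<Longrightarrow> (\<lambda>n. q ^ n * a n) sums f q"
  by (simp add: quat_powser_def)

lemma quat_of_real_power_mult: "(of_real x :: quat) ^ n * a = x ^ n *\<^sub>R a"
  by (simp add: of_real_def flip: of_real_power)

lemma real_powser_zero:
  fixes c :: "nat \<Rightarrow> real"
  assumes "\<And>x. \<bar>x\<bar> < 1 \<Longrightarrow> (\<lambda>n. c n * x ^ n) sums 0"
  shows "c m = 0"
proof (cases "m = 0")
  case True
  then show ?thesis using assms[of 0] by simp
next
  case False
  show ?thesis
  proof (rule ccontr)
    assume "c m \<noteq> 0"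
    \<comment> \<open>A nonzero coefficient of positive index would make the zero function nonzero near 0.\<close>
    then obtain s where s: "0 < s" "\<And>z::real. z \<in> cball 0 s - {0} \<Longrightarrow> (0::real) \<noteq> 0"
      using powser_0_nonzero[of 1 0 c "\<lambda>_. 0" m] assms False by auto
    then show False using s(2)[of s] by simp
  qed
qed

lemma quat_powser_real_unique:
  assumes a: "\<And>x::real. \<bar>x\<bar> < 1 \<Longrightarrow> (\<lambda>n. (of_real x) ^ n * a n) sums g x"
    and b: "\<And>x::real. \<bar>x\<bar> < 1 \<Longrightarrow> (\<lambda>n. (of_real x) ^ n * b n) sums (g x :: quat)"
  shows "a = b"
proof (rule ext, rule euclidean_eqI)
  fix n and e :: quat
  have "inner (a n - b n) e = 0"
  proof (rule real_powser_zero)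
    fix x :: real assume "\<bar>x\<bar> < 1"
    from sums_diff[OF a[OF this] b[OF this]]
    have "(\<lambda>n. x ^ n *\<^sub>R (a n - b n)) sums 0"
      by (simp add: quat_of_real_power_mult scaleR_diff_right)
    from bounded_linear.sums[OF bounded_linear_inner_left[of e] this]
    show "(\<lambda>n. inner (a n - b n) e * x ^ n) sums 0" by (simp add: mult.commute)
  qed
  then show "inner (a n) e = inner (b n) e" by (simp add: inner_diff_left)
qed

lemma quat_powser_unique:
  assumes "quat_powser a f" "quat_powser b f"
  shows "a = b"
  using assms by (intro quat_powser_real_unique[of a "\<lambda>x. f (of_real x)" b])
    (auto intro!: quat_powserD)

lemma slice_coeff_eq:
  assumes "quat_powser a f"
  shows "slice_coeff f = a"
  unfolding slice_coeff_def quat_powser_def[symmetric]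
  using assms quat_powser_unique by blast

text \<open>The continuous partial derivatives make \<open>f\<close> real differentiable on the slice, and the
  Cauchy--Riemann equation of slice regularity makes its complex coordinates holomorphic.\<close>

lemma slice_regular_holomorphic:
  assumes reg: "slice_regular_on f (ball 0 1)" and I: "I \<in> imag_units"
  shows "(\<lambda>z. slice_part I (f (slice_of I z) * v)) holomorphic_on ball 0 1"
  unfolding holomorphic_on_def
proof
  fix z :: complex assume "z \<in> ball 0 1"
  then have z: "cmod z < 1" by simp
  define x y where "x = Re z" and "y = Im z"
  define d where "d = (1 - cmod z) / 2"
  define X Y where "X = {x - d<..<x + d}" and "Y = {y - d<..<y + d}"
  have d: "d > 0" using z by (simp add: d_def)
  have XY: "x \<in> X" "y \<in> Y" using d by (auto simp: X_def Y_def)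
  have dom: "qpt I s t \<in> ball 0 1" if "s \<in> X" "t \<in> Y" for s t
  proof -
    have "cmod (Complex s t) \<le> cmod z + cmod (Complex s t - z)"
      using norm_triangle_sub by blast
    also have "cmod (Complex s t - z) \<le> \<bar>s - x\<bar> + \<bar>t - y\<bar>"
      using cmod_le[of "Complex s t - z"] by (simp add: x_def y_def)
    also have "\<dots> < 2 * d" using that by (auto simp: X_def Y_def)
    also have "cmod z + 2 * d = 1" by (simp add: d_def field_simps)
    finally show ?thesis by (simp add: qpt_eq_slice_of norm_slice_of[OF I])
  qed
  define dx dy where "dx = slice_dx I f x y" and "dy = slice_dy I f x y"
  have r: "(\<lambda>t. f (qpt I t t')) differentiable (at t)" "(\<lambda>t'. f (qpt I t t')) differentiable (at t')"
    "(1/2) *\<^sub>R (slice_dx I f t t' + I * slice_dy I f t t') = 0" if "qpt I t t' \<in> ball 0 1" for t t'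
    using reg I that unfolding slice_regular_on_def by blast+
  have dxy: "((\<lambda>(s, t). f (qpt I s t)) has_derivative (\<lambda>(h, k). h *\<^sub>R dx + k *\<^sub>R dy))
      (at (x, y) within X \<times> Y)"
  proof -
    have "((\<lambda>(s, t). f (qpt I s t)) has_derivative
        (\<lambda>(h, k). h *\<^sub>R dx + blinfun_scaleR_left (slice_dy I f x y) k)) (at (x, y) within X \<times> Y)"
    proof (rule has_derivative_partialsI)
      show "((\<lambda>s. f (qpt I s y)) has_derivative (\<lambda>h. h *\<^sub>R dx)) (at x within X)"
        using r(1)[OF dom[OF XY]] unfolding dx_def slice_dx_def
        by (auto simp: vector_derivative_works has_vector_derivative_def
            intro: has_derivative_at_withinI)
      show "((\<lambda>t. f (qpt I s t)) has_derivative blinfun_scaleR_left (slice_dy I f s t)) (at t within Y)"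
        if "s \<in> X" "t \<in> Y" for s t
        using r(2)[OF dom[OF that]] unfolding slice_dy_def blinfun_scaleR_left.rep_eq
        by (auto simp: vector_derivative_works has_vector_derivative_def
            intro: has_derivative_at_withinI)
      have "continuous_on {(x, y). qpt I x y \<in> ball 0 1} (\<lambda>(x, y). slice_dy I f x y)"
        using reg I unfolding slice_regular_on_def by blast
      then have "continuous_on (X \<times> Y) (\<lambda>(x, y). slice_dy I f x y)"
        by (rule continuous_on_subset) (use dom in auto)
      from bounded_linear.continuous_on[OF bounded_linear_blinfun_scaleR_left this]
      have "continuous_on (X \<times> Y) (\<lambda>(x, y). blinfun_scaleR_left (slice_dy I f x y))"
        by (simp add: case_prod_beta')
      then show "continuous (at (x, y) within X \<times> Y) (\<lambda>(x, y). blinfun_scaleR_left (slice_dy I f x y))"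
        using XY by (simp add: continuous_on_eq_continuous_within)
    qed (use XY in \<open>auto simp: Y_def\<close>)
    then show ?thesis by (simp add: dy_def)
  qed
  have "open (X \<times> Y)" by (simp add: X_def Y_def open_Times)
  then have "((\<lambda>(s, t). f (qpt I s t)) has_derivative (\<lambda>(h, k). h *\<^sub>R dx + k *\<^sub>R dy)) (at (Re z, Im z))"
    using dxy XY at_within_open[of "(x, y)" "X \<times> Y"] by (simp add: x_def y_def)
  moreover have "((\<lambda>z. (Re z, Im z)) has_derivative (\<lambda>z. (Re z, Im z))) (at z)"
    by (intro bounded_linear_imp_has_derivative bounded_linear_Pair bounded_linear_Re bounded_linear_Im)
  ultimately have "((\<lambda>z. f (slice_of I z)) has_derivative (\<lambda>h. Re h *\<^sub>R dx + Im h *\<^sub>R dy)) (at z)"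
    using has_derivative_compose by (fastforce simp: slice_of_def)
  moreover have "bounded_linear (\<lambda>p. slice_part I (p * v))"
    by (intro bounded_linear_compose[OF bounded_linear_slice_part] bounded_linear_mult_left)
  ultimately have D: "((\<lambda>z. slice_part I (f (slice_of I z) * v)) has_derivative
      (\<lambda>h. slice_part I ((Re h *\<^sub>R dx + Im h *\<^sub>R dy) * v))) (at z)"
    using bounded_linear.has_derivative by blast
  have "dx + I * dy = 0" using r(3)[OF dom[OF XY]] by (simp add: dx_def dy_def)
  then have "I * (dx + I * dy) = 0" by simp
  then have dy: "dy = I * dx"
    using imag_units_mult_self[OF I] by (simp add: distrib_left flip: mult.assoc)
  have "(\<lambda>h. slice_part I ((Re h *\<^sub>R dx + Im h *\<^sub>R dy) * v)) = (*) (slice_part I (dx * v))"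
  proof
    fix h
    have "(Re h *\<^sub>R dx + Im h *\<^sub>R dy) * v = slice_of I h * (dx * v)"
      by (simp add: slice_of_alt dy algebra_simps)
    then show "slice_part I ((Re h *\<^sub>R dx + Im h *\<^sub>R dy) * v) = slice_part I (dx * v) * h"
      by (simp add: slice_part_mult[OF I])
  qed
  with D have "((\<lambda>z. slice_part I (f (slice_of I z) * v)) has_field_derivative
      slice_part I (dx * v)) (at z)"
    by (simp add: has_field_derivative_def)
  then show "(\<lambda>z. slice_part I (f (slice_of I z) * v)) field_differentiable at z within ball 0 1"
    using field_differentiable_at_within field_differentiable_def by blast
qed

text \<open>On each slice the two complex coordinates have Taylor series, which combine to a series with
  quaternionic coefficients. All slices share the real axis, so the coefficients do not depend on
  the slice.\<close>

theorem slice_regular_powser: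
  assumes reg: "slice_regular_on f (ball 0 1)"
  obtains a where "quat_powser a f"
proof -
  have ex: "\<exists>a. \<forall>z. cmod z < 1 \<longrightarrow> (\<lambda>n. slice_of I z ^ n * a n) sums f (slice_of I z)"
    if I: "I \<in> imag_units" for I
  proof -
    obtain J where J: "J \<in> imag_units" and IJ: "I * J = - (J * I)"
      using imag_units_anticommuting[OF I] by blast
    have "\<exists>A. \<forall>z. cmod z < 1 \<longrightarrow> (\<lambda>n. A n * z ^ n) sums slice_part I (f (slice_of I z) * v)" for v
      using holomorphic_power_series[OF slice_regular_holomorphic[OF reg I, of v]]
      by (intro exI[of _ "\<lambda>n. (deriv ^^ n) (\<lambda>z. slice_part I (f (slice_of I z) * v)) 0 / fact n"]) auto
    then obtain A B where A: "\<And>z. cmod z < 1 \<Longrightarrow> (\<lambda>n. A n * z ^ n) sums slice_part I (f (slice_of I z) * 1)"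
      and B: "\<And>z. cmod z < 1 \<Longrightarrow> (\<lambda>n. B n * z ^ n) sums slice_part I (f (slice_of I z) * - J)"
      by metis
    have "(\<lambda>n. slice_of I z ^ n * (slice_of I (A n) + slice_of I (B n) * J)) sums f (slice_of I z)"
      if z: "cmod z < 1" for z
    proof -
      have comm: "slice_of I (c * z ^ n) = slice_of I z ^ n * slice_of I c" for c n
        by (metis I mult.commute slice_of_mult slice_of_power)
      have "(\<lambda>n. slice_of I (A n * z ^ n)) sums slice_of I (slice_part I (f (slice_of I z)))"
        using bounded_linear.sums[OF bounded_linear_slice_of A[OF z]] by simp
      moreover have "(\<lambda>n. slice_of I (B n * z ^ n) * J) sums
          (slice_of I (slice_part I (f (slice_of I z) * - J)) * J)"
        by (intro sums_mult2 bounded_linear.sums[OF bounded_linear_slice_of B[OF z]])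
      ultimately have "(\<lambda>n. slice_of I (A n * z ^ n) + slice_of I (B n * z ^ n) * J) sums
          (slice_of I (slice_part I (f (slice_of I z))) +
           slice_of I (slice_part I (f (slice_of I z) * - J)) * J)"
        by (rule sums_add)
      also have "(\<lambda>n. slice_of I (A n * z ^ n) + slice_of I (B n * z ^ n) * J) =
          (\<lambda>n. slice_of I z ^ n * (slice_of I (A n) + slice_of I (B n) * J))"
        by (simp add: comm distrib_left mult.assoc)
      finally show ?thesis unfolding slice_decomposition[OF I J IJ] .
    qed
    then show ?thesis
      by (intro exI[of _ "\<lambda>n. slice_of I (A n) + slice_of I (B n) * J"]) simp
  qed
  define c where "c I = (SOME a. \<forall>z. cmod z < 1 \<longrightarrow> (\<lambda>n. slice_of I z ^ n * a n) sums f (slice_of I z))" for I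
  have c: "(\<lambda>n. slice_of I z ^ n * c I n) sums f (slice_of I z)" if "I \<in> imag_units" "cmod z < 1" for I z
    using someI_ex[OF ex[OF that(1)]] that(2) unfolding c_def by blast
  have same: "c I = c I'" if "I \<in> imag_units" "I' \<in> imag_units" for I I'
  proof (rule quat_powser_real_unique)
    fix x :: real assume "\<bar>x\<bar> < 1"
    then show "(\<lambda>n. of_real x ^ n * c I n) sums f (of_real x)" "(\<lambda>n. of_real x ^ n * c I' n) sums f (of_real x)"
      using c[OF that(1), of "of_real x"] c[OF that(2), of "of_real x"] by simp_all
  qed
  have "quat_powser (c (Quat 0 1 0 0)) f"
    unfolding quat_powser_def
  proof
    fix q :: quat assume q: "q \<in> ball 0 1"
    obtain I z where I: "I \<in> imag_units" and qz: "q = slice_of I z" using quat_in_slice by blast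
    show "(\<lambda>n. q ^ n * c (Quat 0 1 0 0) n) sums f q"
      using c[OF I, of z] same[OF I imag_units_nonempty] q by (simp add: qz norm_slice_of[OF I])
  qed
  then show ?thesis by (rule that)
qed

lemma slice_deriv_0:
  assumes reg: "slice_regular_on f (ball 0 1)" and a: "quat_powser a f"
  shows "slice_deriv f 0 = a 1"
proof -
  have dx: "slice_dx I f 0 0 = a 1" if I: "I \<in> imag_units" for I
  proof -
    have "qpt I 0 0 \<in> ball 0 1" by (simp add: qpt_def)
    then have "(\<lambda>t. f (qpt I t 0)) differentiable (at 0)"
      using reg I unfolding slice_regular_on_def by blast
    then have D: "((\<lambda>t. f (of_real t)) has_vector_derivative slice_dx I f 0 0) (at 0)"
      by (simp add: vector_derivative_works slice_dx_def qpt_def)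
    show ?thesis
    proof (rule euclidean_eqI)
      fix e :: quat
      have "((\<lambda>t. inner (f (of_real t)) e) has_vector_derivative inner (slice_dx I f 0 0) e) (at 0)"
        by (rule bounded_linear.has_vector_derivative[OF bounded_linear_inner_left D])
      then have De: "((\<lambda>t. inner (f (of_real t)) e) has_field_derivative inner (slice_dx I f 0 0) e) (at 0)"
        by (simp add: has_real_derivative_iff_has_vector_derivative)
      have "(\<lambda>n. inner (a n) e * t ^ n) sums inner (f (of_real t)) e" if t: "norm t < 1" for t :: real
        using bounded_linear.sums[OF bounded_linear_inner_left[of e] quat_powserD[OF a, of "of_real t"]] t
        by (simp add: quat_of_real_power_mult mult.commute)
      from termdiffs_sums_strong[OF this De, of 1]
      show "inner (slice_dx I f 0 0) e = inner (a 1) e" by (simp add: diffs_def)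
    qed
  qed
  have val: "(1/2) *\<^sub>R (slice_dx I f x y - I * slice_dy I f x y) = a 1"
    if I: "I \<in> imag_units" and q: "0 = qpt I x y" for I x y
  proof -
    have "slice_of I (Complex x y) = slice_of I 0" using q by (simp add: qpt_eq_slice_of)
    then have xy: "x = 0" "y = 0" by (simp_all only: slice_of_eq_iff[OF I]) (simp_all add: complex_eq_iff)
    have "qpt I 0 0 \<in> ball 0 1" by (simp add: qpt_def)
    then have "(1/2) *\<^sub>R (slice_dx I f 0 0 + I * slice_dy I f 0 0) = 0"
      using reg I unfolding slice_regular_on_def by blast
    then have "- (I * slice_dy I f 0 0) = slice_dx I f 0 0"
      by (simp add: minus_unique add.commute eq_neg_iff_add_eq_0)
    then have "slice_dx I f 0 0 - I * slice_dy I f 0 0 = 2 *\<^sub>R a 1"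
      using dx[OF I] by (simp add: scaleR_2 diff_conv_add_uminus del: add_uminus_conv_diff)
    then show ?thesis by (simp add: xy)
  qed
  have "0 = qpt (Quat 0 1 0 0) 0 0" by (simp add: qpt_def)
  show ?thesis
    unfolding slice_deriv_def 
  proof (rule the_equality)
    show "\<exists>I\<in>imag_units. \<exists>x y. 0 = qpt I x y \<and>
        a 1 = (1/2) *\<^sub>R (slice_dx I f x y - I * slice_dy I f x y)"
      using val[OF imag_units_nonempty \<open>0 = qpt (Quat 0 1 0 0) 0 0\<close>] \<open>0 = qpt (Quat 0 1 0 0) 0 0\<close>
      by (intro bexI[OF _ imag_units_nonempty] exI[of _ 0]) simp
  qed (use val in fastforce)
qed

section \<open>Stem functions and values taken twice\<close>

lemma quat_powser_at_0:
  assumes "quat_powser a f"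
  shows "f 0 = a 0"
proof -
  have "(\<lambda>n. 0 ^ n * a n) = (\<lambda>n. if n = 0 then a n else 0)" by (auto simp: power_0_left)
  then show ?thesis
    using quat_powserD[OF assms, of 0] sums_single[of 0 a] by (simp add: sums_iff)
qed

lemma quat_powser_abs_summable:
  assumes a: "quat_powser a f" and r: "0 \<le> r" "r < 1"
  shows "summable (\<lambda>n. norm (a n) * r ^ n)"
proof -
  obtain s where s: "r < s" "s < 1" using dense r by blast
  have "summable (\<lambda>n. of_real s ^ n * a n)"
    using quat_powserD[OF a, of "of_real s"] s r by (auto simp: sums_iff)
  then have "summable (\<lambda>n. a n * of_real s ^ n)"
    by (simp add: of_real_def flip: of_real_power)
  from powser_insidea[OF this, of "of_real r"] show ?thesis
    using r s by (simp add: norm_mult norm_power)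
qed

lemma quat_powser_continuous_on:
  assumes a: "quat_powser a f"
  shows "continuous_on (ball 0 1) f"
proof -
  have cont: "continuous_on (cball 0 r) f" if r: "0 \<le> r" "r < 1" for r
  proof -
    have "uniform_limit (cball 0 r) (\<lambda>N q. \<Sum>n<N. q ^ n * a n) (\<lambda>q. \<Sum>n. q ^ n * a n) sequentially"
    proof (rule Weierstrass_m_test)
      show "norm (q ^ n * a n) \<le> norm (a n) * r ^ n" if "q \<in> cball 0 r" for n q
      proof -
        have "norm (q ^ n * a n) = norm q ^ n * norm (a n)" by (simp add: norm_mult norm_power)
        also have "\<dots> \<le> r ^ n * norm (a n)"
          using that by (intro mult_right_mono power_mono) auto
        finally show ?thesis by (simp add: mult.commute)
      qed
    qed (rule quat_powser_abs_summable[OF a r])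
    then have lim: "continuous_on (cball 0 r) (\<lambda>q. \<Sum>n. q ^ n * a n)"
      by (rule uniform_limit_theorem[rotated]) (auto intro!: always_eventually continuous_intros)
    have eq: "(\<Sum>n. q ^ n * a n) = f q" if "q \<in> cball 0 r" for q
      using quat_powserD[OF a, of q] that r by (simp add: sums_iff)
    have "continuous_on (cball 0 r) (\<lambda>q. \<Sum>n. q ^ n * a n) = continuous_on (cball 0 r) f"
      by (rule continuous_on_cong) (use eq in auto)
    with lim show ?thesis by simp
  qed
  show ?thesis
  proof (rule continuous_at_imp_continuous_on, rule ballI)
    fix q :: quat assume "q \<in> ball 0 1"
    then obtain r where r: "norm q < r" "r < 1" using dense by auto
    then have "0 \<le> r" by (smt (verit) norm_ge_zero)
    then have "continuous_on (ball 0 r) f"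
      using cont[of r] r continuous_on_subset ball_subset_cball by blast
    then show "isCont f q" using r by (simp add: continuous_on_eq_continuous_at)
  qed
qed

text \<open>The component of \<open>f\<close> along the basis vector \<open>e\<close>, as a complex power series with the real
  coefficients \<open>inner (a n) e\<close>. The next two definitions collect the real and the imaginary parts
  of the four components into quaternions; then \<open>f\<close> takes the value
  \<open>stem_re a z + I * stem_im a z\<close> at \<open>x + yI\<close>, for every \<open>I\<close>.\<close>

definition stem :: "(nat \<Rightarrow> quat) \<Rightarrow> quat \<Rightarrow> complex \<Rightarrow> complex" where
  "stem a e z = (\<Sum>n. of_real (inner (a n) e) * z ^ n)"

definition stem_re :: "(nat \<Rightarrow> quat) \<Rightarrow> complex \<Rightarrow> quat" where
  "stem_re a z = (\<Sum>e\<in>Basis. Re (stem a e z) *\<^sub>R e)"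

definition stem_im :: "(nat \<Rightarrow> quat) \<Rightarrow> complex \<Rightarrow> quat" where
  "stem_im a z = (\<Sum>e\<in>Basis. Im (stem a e z) *\<^sub>R e)"

lemma stem_sums:
  assumes a: "quat_powser a f" and z: "cmod z < 1"
  shows "(\<lambda>n. of_real (inner (a n) e) * z ^ n) sums stem a e z"
proof -
  have "summable (\<lambda>n. norm (a n) * cmod z ^ n * norm e)"
    by (intro summable_mult2 quat_powser_abs_summable[OF a]) (use z in auto)
  moreover have "cmod (of_real (inner (a n) e) * z ^ n) \<le> norm (a n) * cmod z ^ n * norm e" for n
    using mult_right_mono[OF Cauchy_Schwarz_ineq2[of "a n" e], of "cmod z ^ n"]
    by (simp add: norm_mult norm_power mult.commute mult.left_commute)
  ultimately have "summable (\<lambda>n. of_real (inner (a n) e) * z ^ n)"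
    by (rule summable_comparison_test'[of _ 0])
  then show ?thesis unfolding stem_def by (rule summable_sums)
qed

lemma holomorphic_stem:
  assumes "quat_powser a f"
  shows "stem a e holomorphic_on ball 0 1"
  using stem_sums[OF assms]
  by (intro power_series_holomorphic[where a = "\<lambda>n. of_real (inner (a n) e)"]) simp

lemma quat_powser_slice:
  assumes a: "quat_powser a f" and I: "I \<in> imag_units" and z: "cmod z < 1"
  shows "f (slice_of I z) = stem_re a z + I * stem_im a z"
proof -
  have "(\<lambda>n. \<Sum>e\<in>Basis. Re (of_real (inner (a n) e) * z ^ n) *\<^sub>R e) sums stem_re a z"
    unfolding stem_re_def
    by (intro sums_sum bounded_linear.sums[OF bounded_linear_scaleR_left]
        bounded_linear.sums[OF bounded_linear_Re] stem_sums[OF a z])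
  then have re: "(\<lambda>n. Re (z ^ n) *\<^sub>R a n) sums stem_re a z"
    by (simp add: mult.commute[of _ "Re _"] euclidean_representation flip: scaleR_scaleR scaleR_sum_right)
  have "(\<lambda>n. \<Sum>e\<in>Basis. Im (of_real (inner (a n) e) * z ^ n) *\<^sub>R e) sums stem_im a z"
    unfolding stem_im_def
    by (intro sums_sum bounded_linear.sums[OF bounded_linear_scaleR_left]
        bounded_linear.sums[OF bounded_linear_Im] stem_sums[OF a z])
  then have im: "(\<lambda>n. Im (z ^ n) *\<^sub>R a n) sums stem_im a z"
    by (simp add: mult.commute[of _ "Im _"] euclidean_representation flip: scaleR_scaleR scaleR_sum_right)
  have "(\<lambda>n. Re (z ^ n) *\<^sub>R a n + I * (Im (z ^ n) *\<^sub>R a n)) sums (stem_re a z + I * stem_im a z)"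
    by (intro sums_add sums_mult re im)
  moreover have "Re (z ^ n) *\<^sub>R a n + I * (Im (z ^ n) *\<^sub>R a n) = slice_of I z ^ n * a n" for n
  proof -
    have "slice_of I z ^ n = Re (z ^ n) *\<^sub>R 1 + Im (z ^ n) *\<^sub>R I"
      by (metis I slice_of_alt slice_of_power)
    then show ?thesis by (simp add: distrib_right)
  qed
  ultimately show ?thesis
    using quat_powserD[OF a, of "slice_of I z"] z by (simp add: norm_slice_of[OF I] sums_iff)
qed

text \<open>The value of the symmetrization of a slice regular function on a sphere \<open>x + yS\<close> where the
  function is \<open>x + yL \<mapsto> b + L * d\<close>: the sum of the squares of the four complexified components.
  It is holomorphic in the stem functions.\<close>

definition symm_value :: "quat \<Rightarrow> quat \<Rightarrow> complex" where
  "symm_value b d = (Complex (qre b) (qre d))\<^sup>2 + (Complex (qi b) (qi d))\<^sup>2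
    + (Complex (qj b) (qj d))\<^sup>2 + (Complex (qk b) (qk d))\<^sup>2"

text \<open>The modulus of the symmetrization is the product of the largest and the smallest modulus
  that the function takes on the sphere. With \<open>P = \<bar>b\<bar>\<^sup>2 + \<bar>d\<bar>\<^sup>2\<close> and \<open>W\<close> the imaginary part of
  \<open>b * qcnj d\<close>, the squared modulus at \<open>L\<close> is \<open>P + 2 * inner W L\<close>, so the extremes are
  \<open>P + 2\<bar>W\<bar>\<close> and \<open>P - 2\<bar>W\<bar>\<close>.\<close>

lemma symm_value_extremes:
  obtains K where "K \<in> imag_units"
    "(cmod (symm_value b d))\<^sup>2 = (norm (b + K * d))\<^sup>2 * (norm (b - K * d))\<^sup>2"
    "\<And>L. L \<in> imag_units \<Longrightarrow> norm (b - K * d) \<le> norm (b + L * d)"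
    "\<And>L. L \<in> imag_units \<Longrightarrow> norm (b + L * d) \<le> norm (b + K * d)"
proof -
  define P where "P = (norm b)\<^sup>2 + (norm d)\<^sup>2"
  define W where "W = (let w = b * qcnj d in Quat 0 (qi w) (qj w) (qk w))"
  define u where "u = norm W"
  have expand: "(norm (b + L * d))\<^sup>2 = P + 2 * inner W L" if L: "L \<in> imag_units" for L
  proof -
    have "(norm (b + L * d))\<^sup>2 = (norm b)\<^sup>2 + (norm (L * d))\<^sup>2 + 2 * inner b (L * d)"
      by (simp add: power2_norm_eq_inner inner_add_left inner_add_right inner_commute)
    moreover have "inner b (L * d) = inner W L"
      using L by (simp add: W_def Let_def imag_units_iff inner_quat_def times_quat_def algebra_simps)
    ultimately show ?thesis by (simp add: P_def norm_mult norm_imag_units[OF L])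
  qed
  have bound: "\<bar>inner W L\<bar> \<le> u" if "L \<in> imag_units" for L
    using Cauchy_Schwarz_ineq2[of W L] norm_imag_units[OF that] by (simp add: u_def)
  obtain K where K: "K \<in> imag_units" "inner W K = u"
  proof (cases "u = 0")
    case True
    then show ?thesis using that[OF imag_units_nonempty] by (simp add: u_def)
  next
    case False
    have W: "qre W = 0" by (simp add: W_def Let_def)
    have u2: "u\<^sup>2 = (qi W)\<^sup>2 + (qj W)\<^sup>2 + (qk W)\<^sup>2" by (simp add: u_def norm_quat_power2 W)
    have "(qi W / u)\<^sup>2 + (qj W / u)\<^sup>2 + (qk W / u)\<^sup>2 = u\<^sup>2 / u\<^sup>2"
      by (simp only: power_divide add_divide_distrib[symmetric] u2)
    then have "(1 / u) *\<^sub>R W \<in> imag_units" using False by (simp add: imag_units_iff W)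
    moreover have "inner W ((1 / u) *\<^sub>R W) = u"
      using False by (simp add: u_def power2_norm_eq_inner[symmetric] power2_eq_square)
    ultimately show ?thesis using that by blast
  qed
  have "b - K * d = b + (- K) * d" by simp
  then have minus: "(norm (b - K * d))\<^sup>2 = P - 2 * u"
    using expand[OF imag_units_uminus[OF K(1)]] K(2) by simp
  have plus: "(norm (b + K * d))\<^sup>2 = P + 2 * u" using expand[OF K(1)] K(2) by simp
  have u2: "u\<^sup>2 + (inner b d)\<^sup>2 = (norm b)\<^sup>2 * (norm d)\<^sup>2"
    unfolding u_def norm_quat_power2 W_def Let_def
    by (simp add: inner_quat_def times_quat_def power2_eq_square algebra_simps)
  have "symm_value b d = Complex ((norm b)\<^sup>2 - (norm d)\<^sup>2) (2 * inner b d)"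
    unfolding norm_quat_power2
    by (simp add: symm_value_def complex_eq_iff inner_quat_def power2_eq_square)
  then have "(cmod (symm_value b d))\<^sup>2 = ((norm b)\<^sup>2 - (norm d)\<^sup>2)\<^sup>2 + 4 * (inner b d)\<^sup>2"
    by (simp add: cmod_power2 power_mult_distrib)
  also have "\<dots> = (P + 2 * u) * (P - 2 * u)"
    using u2 by (simp add: P_def power2_eq_square algebra_simps)
  finally have S: "(cmod (symm_value b d))\<^sup>2 = (norm (b + K * d))\<^sup>2 * (norm (b - K * d))\<^sup>2"
    by (simp add: minus plus)
  show ?thesis
  proof (rule that[OF K(1) S])
    fix L assume L: "L \<in> imag_units"
    have "(norm (b - K * d))\<^sup>2 \<le> (norm (b + L * d))\<^sup>2"
      unfolding minus expand[OF L] using bound[OF L] by simp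
    then show "norm (b - K * d) \<le> norm (b + L * d)" by (rule power2_le_imp_le) simp
    have "(norm (b + L * d))\<^sup>2 \<le> (norm (b + K * d))\<^sup>2"
      unfolding plus expand[OF L] using bound[OF L] by simp
    then show "norm (b + L * d) \<le> norm (b + K * d)" by (rule power2_le_imp_le) simp
  qed
qed

text \<open>A pointwise inequality between the moduli of two functions on a sphere passes to their
  symmetrizations, because it passes to the maximum and to the minimum.\<close>

lemma symm_value_mono:
  assumes le: "\<And>L. L \<in> imag_units \<Longrightarrow> norm (b + L * d) \<le> norm (b' + L * d')"
  shows "cmod (symm_value b d) \<le> cmod (symm_value b' d')"
proof -
  obtain K where K: "K \<in> imag_units"
    "(cmod (symm_value b d))\<^sup>2 = (norm (b + K * d))\<^sup>2 * (norm (b - K * d))\<^sup>2"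
    "\<And>L. L \<in> imag_units \<Longrightarrow> norm (b - K * d) \<le> norm (b + L * d)"
    using symm_value_extremes[of b d] by metis
  obtain K' where K': "K' \<in> imag_units"
    "(cmod (symm_value b' d'))\<^sup>2 = (norm (b' + K' * d'))\<^sup>2 * (norm (b' - K' * d'))\<^sup>2"
    "\<And>L. L \<in> imag_units \<Longrightarrow> norm (b' + L * d') \<le> norm (b' + K' * d')"
    using symm_value_extremes[of b' d'] by metis
  have "norm (b + K * d) \<le> norm (b' + K' * d')"
    using le[OF K(1)] K'(3)[OF K(1)] by simp
  moreover have "norm (b - K * d) \<le> norm (b' - K' * d')"
    using le[OF imag_units_uminus[OF K'(1)]] K(3)[OF imag_units_uminus[OF K'(1)]] by simp
  ultimately have "(cmod (symm_value b d))\<^sup>2 \<le> (cmod (symm_value b' d'))\<^sup>2"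
    unfolding K(2) K'(2) by (intro mult_mono power_mono) auto
  then show ?thesis by (rule power2_le_imp_le) simp
qed

lemma symm_value_eq_0_iff:
  "symm_value b d = 0 \<longleftrightarrow> (\<exists>L\<in>imag_units. b + L * d = 0)"
proof -
  obtain K where K: "K \<in> imag_units"
    "(cmod (symm_value b d))\<^sup>2 = (norm (b + K * d))\<^sup>2 * (norm (b - K * d))\<^sup>2"
    "\<And>L. L \<in> imag_units \<Longrightarrow> norm (b - K * d) \<le> norm (b + L * d)"
    using symm_value_extremes[of b d] by metis
  show ?thesis
  proof
    assume "symm_value b d = 0"
    then have "b + K * d = 0 \<or> b + (- K) * d = 0" using K(2) by simp
    then show "\<exists>L\<in>imag_units. b + L * d = 0" using K(1) imag_units_uminus by blast
  next
    assume "\<exists>L\<in>imag_units. b + L * d = 0"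
    then obtain L where "L \<in> imag_units" "b + L * d = 0" by blast
    then have "norm (b - K * d) = 0" using K(3)[of L] by simp
    then show "symm_value b d = 0" using K(2) by simp
  qed
qed

lemma stem_re_im_components:
  "Complex (qre (stem_re a z)) (qre (stem_im a z)) = stem a (Quat 1 0 0 0) z"
  "Complex (qi (stem_re a z)) (qi (stem_im a z)) = stem a (Quat 0 1 0 0) z"
  "Complex (qj (stem_re a z)) (qj (stem_im a z)) = stem a (Quat 0 0 1 0) z"
  "Complex (qk (stem_re a z)) (qk (stem_im a z)) = stem a (Quat 0 0 0 1) z"
  by (simp_all add: stem_re_def stem_im_def Basis_quat_def complex_eq_iff)

lemma quat_one_minus_le:
  assumes "norm p \<le> 1" "0 \<le> c" "c \<le> 1"
  shows "norm (p - of_real c) \<le> norm (1 - of_real c * (p::quat))"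
proof -
  obtain I z where I: "I \<in> imag_units" "p = slice_of I z" using quat_in_slice by blast
  have "p - of_real c = slice_of I (z - of_real c)" "1 - of_real c * p = slice_of I (1 - of_real c * z)"
    using I by (simp_all add: slice_of_diff slice_of_mult)
  then show ?thesis
    using cmod_one_minus_le[of z c] assms I by (simp only: norm_slice_of)
qed

lemma quat_powser_mult_right:
  assumes "quat_powser a f"
  shows "quat_powser (\<lambda>n. a n * v) (\<lambda>q. f q * v)"
  using assms unfolding quat_powser_def by (auto simp: mult.assoc[symmetric] intro: sums_mult2)

lemma slice_part_sums:
  assumes a: "quat_powser a f" and I: "I \<in> imag_units" and z: "cmod z < 1"
  shows "(\<lambda>n. slice_part I (a n) * z ^ n) sums slice_part I (f (slice_of I z))"
proof -
  have "(\<lambda>n. slice_part I (slice_of I z ^ n * a n)) sums slice_part I (f (slice_of I z))"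
    by (intro bounded_linear.sums[OF bounded_linear_slice_part] quat_powserD[OF a])
      (simp add: norm_slice_of[OF I] z)
  then show ?thesis
    by (simp add: slice_part_mult[OF I] mult.commute flip: slice_of_power[OF I])
qed

lemma holomorphic_slice_part:
  assumes a: "quat_powser a f" and I: "I \<in> imag_units"
  shows "(\<lambda>z. slice_part I (f (slice_of I z))) holomorphic_on ball 0 1"
  using slice_part_sums[OF a I]
  by (intro power_series_holomorphic[where a = "\<lambda>n. slice_part I (a n)"]) simp

text \<open>Two points on one slice: the slice part of \<open>f\<close> is an ordinary function that takes the value
  \<open>c\<close> twice, so the Moebius function sending \<open>c\<close> to 0 produces two zeros and the value \<open>- c\<close> at 0.\<close>

lemma same_slice_double_value:
  assumes a: "quat_powser a f" and fb: "\<And>q. norm q < 1 \<Longrightarrow> norm (f q) < 1" and f0: "f 0 = 0"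
    and I: "I \<in> imag_units" and z: "cmod z1 < 1" "cmod z2 < 1" "z1 \<noteq> z2"
    and c: "f (slice_of I z1) = of_real c" "f (slice_of I z2) = of_real c"
  shows "\<bar>c\<bar> \<le> cmod z1 * cmod z2"
proof -
  define F where "F z = slice_part I (f (slice_of I z))" for z
  have Fb: "cmod (F z) < 1" if "cmod z < 1" for z
    unfolding F_def using cmod_slice_part_le[OF I, of "f (slice_of I z)"] fb[of "slice_of I z"] that
    by (simp add: norm_slice_of[OF I])
  have c1: "\<bar>c\<bar> < 1" using fb[of "slice_of I z1"] c z by (simp add: norm_slice_of[OF I])
  have holF: "F holomorphic_on ball 0 1"
    unfolding F_def by (rule holomorphic_slice_part[OF a I])
  have "(\<lambda>z. Moebius_function 0 (of_real c) (F z)) holomorphic_on ball 0 1"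
    using c1 by (intro holomorphic_on_disc_compose[OF holF] Moebius_function_holomorphic Fb) auto
  moreover have "cmod (Moebius_function 0 (of_real c) (F z)) \<le> 1" if "cmod z < 1" for z
    using Moebius_function_norm_lt_1[of "of_real c" "F z" 0] Fb[OF that] c1 by simp
  moreover have "cmod w < 1 \<and> Moebius_function 0 (of_real c) (F w) = 0" if "w \<in> {z1, z2}" for w
    using that z c by (auto simp: F_def I Moebius_function_eq_zero)
  ultimately have "cmod (Moebius_function 0 (of_real c) (F 0)) \<le> (\<Prod>w\<in>{z1, z2}. cmod w)"
    by (intro disc_zeros_bound) auto
  then show ?thesis
    using z by (simp add: F_def f0 Moebius_function_of_zero slice_part_0)
qed

text \<open>Two points on different spheres: the quotient of the symmetrizations of \<open>f - c\<close> and of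
  \<open>1 - c f\<close> is a holomorphic function bounded by 1. It is real on the real axis, so it vanishes at
  both points and at their conjugates, four points in all, and its value at 0 is \<open>c\<^sup>2\<close>.\<close>

lemma distinct_spheres_double_value:
  assumes a: "quat_powser a f" and fb: "\<And>q. norm q < 1 \<Longrightarrow> norm (f q) < 1" and f0: "f 0 = 0"
    and IK: "I1 \<in> imag_units" "I2 \<in> imag_units"
    and z: "cmod z1 < 1" "cmod z2 < 1" "0 < Im z1" "0 < Im z2" "z1 \<noteq> z2"
    and c: "f (slice_of I1 z1) = of_real c" "f (slice_of I2 z2) = of_real c" "0 \<le> c"
  shows "c \<le> cmod z1 * cmod z2"
proof -
  let ?S0 = "stem a (Quat 1 0 0 0)" and ?S1 = "stem a (Quat 0 1 0 0)"
  let ?S2 = "stem a (Quat 0 0 1 0)" and ?S3 = "stem a (Quat 0 0 0 1)"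
  \<comment> \<open>\<open>N\<close> and \<open>D\<close> are the symmetrizations of \<open>f - c\<close> and of \<open>1 - c f\<close>.\<close>
  define N where "N z = (?S0 z - of_real c)\<^sup>2 + (?S1 z)\<^sup>2 + (?S2 z)\<^sup>2 + (?S3 z)\<^sup>2" for z
  define D where "D z = (1 - of_real c * ?S0 z)\<^sup>2 + (of_real c * ?S1 z)\<^sup>2
    + (of_real c * ?S2 z)\<^sup>2 + (of_real c * ?S3 z)\<^sup>2" for z
  have c1: "c < 1" using fb[of "slice_of I1 z1"] c z by (simp add: norm_slice_of IK)
  have N: "N z = symm_value (stem_re a z - of_real c) (stem_im a z)" for z
    unfolding N_def symm_value_def stem_re_im_components[symmetric]
    by (simp add: of_real_quat complex_eq_iff power2_eq_square)
  have D: "D z = symm_value (1 - of_real c * stem_re a z) (- (of_real c * stem_im a z))" for z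
    unfolding D_def symm_value_def stem_re_im_components[symmetric]
    by (simp add: of_real_quat times_quat_def complex_eq_iff power2_eq_square)
  have fL: "stem_re a z + L * stem_im a z = f (slice_of L z)" if "cmod z < 1" "L \<in> imag_units" for z L
    using quat_powser_slice[OF a that(2,1)] by simp
  have comm: "L * (of_real c * p) = of_real c * (L * p)" for L p :: quat
    by (simp add: scaleR_conv_of_real[symmetric])
  have numL: "stem_re a z - of_real c + L * stem_im a z = f (slice_of L z) - of_real c"
    and denL: "1 - of_real c * stem_re a z + L * - (of_real c * stem_im a z) = 1 - of_real c * f (slice_of L z)"
    if "cmod z < 1" "L \<in> imag_units" for z L
    unfolding fL[OF that, symmetric] by (simp_all add: algebra_simps comm)
  have fb': "norm (f (slice_of L z)) < 1" if "cmod z < 1" "L \<in> imag_units" for z L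
    using fb[of "slice_of L z"] that by (simp add: norm_slice_of)
  have D0: "D z \<noteq> 0" if z: "cmod z < 1" for z
    unfolding D symm_value_eq_0_iff
  proof
    assume "\<exists>L\<in>imag_units. 1 - of_real c * stem_re a z + L * - (of_real c * stem_im a z) = 0"
    then obtain L where L: "L \<in> imag_units"
      and "1 - of_real c * stem_re a z + L * - (of_real c * stem_im a z) = 0" by blast
    then have L0: "1 - of_real c * f (slice_of L z) = 0" by (simp only: denL[OF z])
    have "norm (of_real c * f (slice_of L z)) < 1 * 1"
      unfolding norm_mult using c c1 fb'[OF z L] by (intro mult_strict_mono') auto
    then show False using L0 by auto
  qed
  have ND: "cmod (N z) \<le> cmod (D z)" if z: "cmod z < 1" for z
    unfolding N D
  proof (rule symm_value_mono)
    fix L assume L: "L \<in> imag_units"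
    show "norm (stem_re a z - of_real c + L * stem_im a z)
        \<le> norm (1 - of_real c * stem_re a z + L * - (of_real c * stem_im a z))"
      unfolding numL[OF z L] denL[OF z L]
      using fb'[OF z L] c c1 by (intro quat_one_minus_le) auto
  qed
  have N0: "N z = 0" if "cmod z < 1" "L \<in> imag_units" "f (slice_of L z) = of_real c" for z L
    unfolding N symm_value_eq_0_iff using numL[OF that(1,2)] that by auto
  define Z where "Z = {z1, cnj z1, z2, cnj z2}"
  have hol: "(\<lambda>z. N z / D z) holomorphic_on ball 0 1"
    unfolding N_def D_def
    by (intro holomorphic_intros holomorphic_stem[OF a]) (use D0 in \<open>auto simp: D_def\<close>)
  have "cmod (N 0 / D 0) \<le> (\<Prod>w\<in>Z. cmod w)"
  proof (rule disc_zeros_bound[of Z "\<lambda>z. N z / D z"])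
    show "cmod (N z / D z) \<le> 1" if "cmod z < 1" for z
      using ND[OF that] D0[OF that] by (simp add: norm_divide)
    show "cmod w < 1 \<and> N w / D w = 0" if "w \<in> Z" for w
    proof -
      have "N z1 = 0" "N z2 = 0" using N0 z c IK by blast+
      moreover have "N (cnj z1) = 0"
        using N0[of "cnj z1" "- I1"] z c IK by (simp add: slice_of_uminus_cnj imag_units_uminus)
      moreover have "N (cnj z2) = 0"
        using N0[of "cnj z2" "- I2"] z c IK by (simp add: slice_of_uminus_cnj imag_units_uminus)
      ultimately show ?thesis using that z by (auto simp: Z_def)
    qed
  qed (auto simp: Z_def hol)
  moreover have "N 0 / D 0 = of_real (c\<^sup>2)"
  proof -
    have "a 0 = 0" using quat_powser_at_0[OF a] f0 by simp
    moreover have "stem a e 0 = of_real (inner (a 0) e)" for e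
      unfolding stem_def by (rule powser_zero)
    ultimately have "stem a e 0 = 0" for e by simp
    then show ?thesis by (simp add: N_def D_def)
  qed
  moreover have "(\<Prod>w\<in>Z. cmod w) = (cmod z1 * cmod z2)\<^sup>2"
  proof -
    have "z1 \<noteq> cnj z1" "z1 \<noteq> z2" "z1 \<noteq> cnj z2" "cnj z1 \<noteq> z2" "cnj z1 \<noteq> cnj z2" "z2 \<noteq> cnj z2"
      using z by (auto simp: complex_eq_iff)
    then show ?thesis by (simp add: Z_def power2_eq_square)
  qed
  ultimately have "c\<^sup>2 \<le> (cmod z1 * cmod z2)\<^sup>2" by (simp add: norm_power)
  then show ?thesis by (rule power2_le_imp_le) simp
qed

text \<open>The value may be assumed real and nonnegative, since multiplication by a unit constant on
  the right preserves the power series form. If both points are on one sphere but not on one slice,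
  then \<open>f\<close> is constant on that sphere, and a point and its conjugate lie on one slice.\<close>

lemma double_value_bound:
  assumes a: "quat_powser a f" and fb: "\<And>q. norm q < 1 \<Longrightarrow> norm (f q) < 1" and f0: "f 0 = 0"
    and q: "norm q1 < 1" "norm q2 < 1" "q1 \<noteq> q2" and w: "f q1 = f q2"
  shows "norm (f q1) \<le> norm q1 * norm q2"
proof (cases "f q1 = 0")
  case True
  then show ?thesis by simp
next
  case False
  define c where "c = norm (f q1)"
  define v where "v = inverse (f q1) * of_real c"
  define g where "g q = f q * v" for q
  have v: "norm v = 1" using False by (simp add: v_def c_def norm_mult norm_inverse)
  have g: "quat_powser (\<lambda>n. a n * v) g" unfolding g_def by (rule quat_powser_mult_right[OF a])
  have gb: "norm (g q) < 1" if "norm q < 1" for q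
    using fb[OF that] by (simp add: g_def norm_mult v)
  have g0: "g 0 = 0" by (simp add: g_def f0)
  have gc: "g q1 = of_real c" "g q2 = of_real c"
    using False w by (simp_all add: g_def v_def mult.assoc[symmetric])
  have c0: "0 \<le> c" by (simp add: c_def)
  obtain I1 z1 where 1: "I1 \<in> imag_units" "q1 = slice_of I1 z1" "0 \<le> Im z1" by (rule quat_in_slice)
  obtain I2 z2 where 2: "I2 \<in> imag_units" "q2 = slice_of I2 z2" "0 \<le> Im z2" by (rule quat_in_slice)
  have z: "cmod z1 < 1" "cmod z2 < 1" using q 1 2 by (simp_all add: norm_slice_of)
  have same: ?thesis if "I \<in> imag_units" "q1 = slice_of I w1" "q2 = slice_of I w2" for I w1 w2
  proof -
    have "cmod w1 < 1" "cmod w2 < 1" "w1 \<noteq> w2" using q that by (auto simp: norm_slice_of)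
    then have "\<bar>c\<bar> \<le> cmod w1 * cmod w2"
      using that gc by (intro same_slice_double_value[OF g gb g0]) auto
    then show ?thesis using that c0 by (simp add: c_def norm_slice_of)
  qed
  consider "Im z1 = 0" | "Im z2 = 0" | "I1 = I2" | "0 < Im z1" "0 < Im z2" "z1 \<noteq> z2"
    | "0 < Im z1" "z1 = z2" "I1 \<noteq> I2"
    using 1 2 by fastforce
  then show ?thesis
  proof cases
    case 1
    then have "q1 = slice_of I2 z1" using \<open>q1 = slice_of I1 z1\<close> by (simp add: slice_of_alt)
    then show ?thesis using same 2 by blast
  next
    case 2
    then have "q2 = slice_of I1 z2" using \<open>q2 = slice_of I2 z2\<close> by (simp add: slice_of_alt)
    then show ?thesis using same \<open>I1 \<in> imag_units\<close> \<open>q1 = slice_of I1 z1\<close> by blast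
  next
    case 3
    then show ?thesis using same 1 2 by blast
  next
    case 4
    have "c \<le> cmod z1 * cmod z2"
      using 1 2 4 z gc c0 by (intro distinct_spheres_double_value[OF g gb g0]) auto
    then show ?thesis using 1 2 by (simp add: c_def norm_slice_of)
  next
    case 5
    let ?b = "stem_re (\<lambda>n. a n * v) z1" and ?d = "stem_im (\<lambda>n. a n * v) z1"
    have "?b + I1 * ?d = of_real c" "?b + I2 * ?d = of_real c"
      using quat_powser_slice[OF g 1(1) z(1)] quat_powser_slice[OF g 2(1) z(1)] gc 1 2 5 by simp_all
    moreover have "(I1 - I2) * ?d = (?b + I1 * ?d) - (?b + I2 * ?d)" by (simp add: left_diff_distrib)
    ultimately have bc: "?b + I1 * ?d = of_real c" and "(I1 - I2) * ?d = 0" by simp_all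
    then have d: "?d = 0" using 5 by simp
    with bc have "g (slice_of I1 (cnj z1)) = of_real c"
      using quat_powser_slice[OF g imag_units_uminus[OF 1(1)] z(1)] bc
        slice_of_uminus_cnj[of I1 "cnj z1"] by simp
    moreover have "z1 \<noteq> cnj z1" using 5 by (auto simp: complex_eq_iff)
    ultimately have "\<bar>c\<bar> \<le> cmod z1 * cmod (cnj z1)"
      using z gc 1 by (intro same_slice_double_value[OF g gb g0 1(1)]) auto
    then show ?thesis using 1 2 5 c0 by (simp add: c_def norm_slice_of)
  qed
qed

section \<open>The extremal functions\<close>

text \<open>The Taylor coefficients at 0 of \<open>t (t - \<alpha>) / (1 - \<alpha> t)\<close>.\<close>

definition mobius_coeff :: "real \<Rightarrow> nat \<Rightarrow> real" where
  "mobius_coeff \<alpha> n = (if n = 0 then 0 else if n = 1 then - \<alpha> else (1 - \<alpha>\<^sup>2) * \<alpha> ^ (n - 2))"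

lemma mobius_coeff_simps [simp]:
  "mobius_coeff \<alpha> 0 = 0" "mobius_coeff \<alpha> (Suc 0) = - \<alpha>"
  "mobius_coeff \<alpha> (Suc (Suc n)) = (1 - \<alpha>\<^sup>2) * \<alpha> ^ n"
  by (simp_all add: mobius_coeff_def)

lemma mobius_series:
  fixes t :: "'a::{real_normed_field,banach}"
  assumes "0 < \<alpha>" "\<alpha> < 1" "norm t < 1"
  shows "(\<lambda>n. of_real (mobius_coeff \<alpha> n) * t ^ n) sums (t * ((t - of_real \<alpha>) / (1 - of_real \<alpha> * t)))"
proof -
  define w where "w = of_real \<alpha> * t"
  have "norm w < 1 * 1"
    unfolding w_def norm_mult using assms by (intro mult_strict_mono') auto
  then have w: "norm w < 1" "1 - w \<noteq> 0" by auto
  have "(\<lambda>n. of_real (1 - \<alpha>\<^sup>2) * t\<^sup>2 * w ^ n) sums (of_real (1 - \<alpha>\<^sup>2) * t\<^sup>2 * (1 / (1 - w)))"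
    by (intro sums_mult geometric_sums w)
  then have "(\<lambda>n. of_real (mobius_coeff \<alpha> (Suc (Suc n))) * t ^ Suc (Suc n))
      sums (of_real (1 - \<alpha>\<^sup>2) * t\<^sup>2 * (1 / (1 - w)))"
    by (simp add: w_def power_mult_distrib power2_eq_square mult_ac)
  then have "(\<lambda>n. of_real (mobius_coeff \<alpha> (Suc n)) * t ^ Suc n)
      sums (of_real (1 - \<alpha>\<^sup>2) * t\<^sup>2 * (1 / (1 - w)) - of_real \<alpha> * t)"
    using sums_Suc[where f = "\<lambda>n. of_real (mobius_coeff \<alpha> (Suc n)) * t ^ Suc n"] by simp
  then have "(\<lambda>n. of_real (mobius_coeff \<alpha> n) * t ^ n)
      sums (of_real (1 - \<alpha>\<^sup>2) * t\<^sup>2 * (1 / (1 - w)) - of_real \<alpha> * t)"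
    using sums_Suc[where f = "\<lambda>n. of_real (mobius_coeff \<alpha> n) * t ^ n"] by simp
  moreover have "of_real (1 - \<alpha>\<^sup>2) * t\<^sup>2 * (1 / (1 - w)) - of_real \<alpha> * t
      = t * ((t - of_real \<alpha>) / (1 - of_real \<alpha> * t))"
    using w by (simp add: w_def field_simps power2_eq_square)
  ultimately show ?thesis by simp
qed

text \<open>A normal form of the extremal functions that avoids the regular product: the series of
  \<open>t (t - \<alpha>) / (1 - \<alpha> t)\<close> with \<open>t\<^sup>n\<close> replaced by \<open>q\<^sup>n \<eta>\<^sup>n W\<close>, for unit quaternions \<open>\<eta>\<close> and \<open>W\<close>.\<close>

definition extremal_series :: "real \<Rightarrow> (quat \<Rightarrow> quat) \<Rightarrow> quat \<Rightarrow> quat \<Rightarrow> bool" where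
  "extremal_series \<alpha> f \<eta> W \<longleftrightarrow> norm \<eta> = 1 \<and> norm W = 1 \<and>
     quat_powser (\<lambda>n. mobius_coeff \<alpha> n *\<^sub>R (\<eta> ^ n * W)) f"

text \<open>On the diameter through \<open>inverse \<eta>\<close> the powers of \<open>\<eta>\<close> cancel, and the function is the real
  Blaschke product times \<open>W\<close>.\<close>

lemma extremal_series_value:
  assumes f: "extremal_series \<alpha> f \<eta> W" and \<alpha>: "0 < \<alpha>" "\<alpha> < 1" and x: "\<bar>x\<bar> < 1"
  shows "f (x *\<^sub>R inverse \<eta>) = (x * ((x - \<alpha>) / (1 - \<alpha> * x))) *\<^sub>R W"
proof -
  have \<eta>: "norm \<eta> = 1" "\<eta> \<noteq> 0" using f by (auto simp: extremal_series_def)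
  have "norm (x *\<^sub>R inverse \<eta>) < 1" using x \<eta> by (simp add: norm_inverse)
  then have "(\<lambda>n. (x *\<^sub>R inverse \<eta>) ^ n * (mobius_coeff \<alpha> n *\<^sub>R (\<eta> ^ n * W))) sums f (x *\<^sub>R inverse \<eta>)"
    by (intro quat_powserD[of "\<lambda>n. mobius_coeff \<alpha> n *\<^sub>R (\<eta> ^ n * W)"])
      (use f in \<open>simp_all add: extremal_series_def\<close>)
  moreover have t: "(x *\<^sub>R inverse \<eta>) ^ n * (mobius_coeff \<alpha> n *\<^sub>R (\<eta> ^ n * W)) = (mobius_coeff \<alpha> n * x ^ n) *\<^sub>R W" for n
  proof -
    have "inverse \<eta> ^ n * (\<eta> ^ n * W) = W"
      using \<eta> by (simp add: power_inverse mult.assoc[symmetric])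
    then show ?thesis by (simp add: scaleR_power mult.commute)
  qed
  moreover have "(\<lambda>n. (mobius_coeff \<alpha> n * x ^ n) *\<^sub>R W) sums ((x * ((x - \<alpha>) / (1 - \<alpha> * x))) *\<^sub>R W)"
    using bounded_linear.sums[OF bounded_linear_scaleR_left mobius_series[OF \<alpha>, of x]] x by simp
  ultimately show ?thesis unfolding t by (blast intro: sums_unique2)
qed

lemma quat_powser_linear: "quat_powser (\<lambda>n. if n = 0 then c else if n = 1 then d else 0) (\<lambda>p. c + p * d)"
  unfolding quat_powser_def
proof
  fix q :: quat
  have "(\<lambda>n. q ^ n * (if n = 0 then c else if n = 1 then d else 0)) sums
      (\<Sum>n\<in>{0, 1}. q ^ n * (if n = 0 then c else if n = 1 then d else 0))"
    by (intro sums_finite) auto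
  then show "(\<lambda>n. q ^ n * (if n = 0 then c else if n = 1 then d else 0)) sums (c + q * d)"
    by simp
qed

lemma quat_add_qcnj: "\<beta> + qcnj \<beta> = of_real (2 * qre \<beta>)"
  by (simp add: quat_eq_iff of_real_quat)

text \<open>The regular reciprocal of \<open>1 - p \<beta>\<close> is the geometric series. Its sum \<open>s\<close> satisfies
  \<open>s - q s \<beta> = 1\<close>; applying \<open>x \<mapsto> x - q x (qcnj \<beta>)\<close> to this equation turns the left side into the
  symmetrization times \<open>s\<close> and the right side into the regular conjugate.\<close>

lemma quat_powser_reg_recip:
  assumes \<beta>: "norm \<beta> < 1"
  shows "quat_powser (\<lambda>n. \<beta> ^ n) (reg_recip (\<lambda>p. 1 - p * \<beta>))"
proof -
  let ?h = "\<lambda>p. 1 - p * \<beta>"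
  have "quat_powser (\<lambda>n. if n = 0 then 1 else if n = 1 then - \<beta> else 0) ?h"
    using quat_powser_linear[of 1 "- \<beta>"] by simp
  then have ch: "slice_coeff ?h = (\<lambda>n. if n = 0 then 1 else if n = 1 then - \<beta> else 0)"
    by (rule slice_coeff_eq)
  have conj: "reg_conj ?h q = 1 - q * qcnj \<beta>" for q
  proof -
    have "reg_conj ?h q = (\<Sum>n\<in>{0, 1}. q ^ n * qcnj (slice_coeff ?h n))"
      unfolding reg_conj_def by (rule suminf_finite) (auto simp: ch qcnj_def zero_quat_def)
    then show ?thesis by (simp add: ch) (simp add: quat_eq_iff times_quat_def)
  qed
  have "quat_powser (\<lambda>n. if n = 0 then 1 else if n = 1 then - qcnj \<beta> else 0) (reg_conj ?h)"
    using quat_powser_linear[of 1 "- qcnj \<beta>"] unfolding ext[of "reg_conj ?h", OF conj] by simp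
  then have cc: "slice_coeff (reg_conj ?h) = (\<lambda>n. if n = 0 then 1 else if n = 1 then - qcnj \<beta> else 0)"
    by (rule slice_coeff_eq)
  have symm: "reg_symm ?h q = 1 - of_real (2 * qre \<beta>) * q + of_real ((norm \<beta>)\<^sup>2) * q\<^sup>2" for q
  proof -
    define c where "c n = (\<Sum>k\<le>n. slice_coeff ?h k * slice_coeff (reg_conj ?h) (n - k))" for n
    have c3: "c n = 0" if "n \<ge> 3" for n
      unfolding c_def by (rule sum.neutral) (use that in \<open>auto simp: ch cc\<close>)
    have "reg_symm ?h q = (\<Sum>n\<in>{0, 1, 2}. q ^ n * c n)"
      unfolding reg_symm_def reg_prod_def c_def[symmetric]
    proof (rule suminf_finite)
      fix n :: nat assume "n \<notin> {0, 1, 2}"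
      then have "n \<ge> 3" by auto
      then show "q ^ n * c n = 0" using c3 by simp
    qed simp
    moreover have "c 0 = 1" by (simp add: c_def ch cc)
    moreover have "c 1 = - of_real (2 * qre \<beta>)"
      unfolding quat_add_qcnj[symmetric] by (simp add: c_def ch cc)
    moreover have "c 2 = of_real ((norm \<beta>)\<^sup>2)"
      by (simp add: c_def ch cc numeral_2_eq_2 mult_qcnj of_real_def)
    ultimately show ?thesis by (simp add: of_real_def)
  qed
  show ?thesis
    unfolding quat_powser_def
  proof
    fix q :: quat assume "q \<in> ball 0 1"
    then have q: "norm q < 1" by simp
    have qb: "norm q * norm \<beta> < 1 * 1"
      using q \<beta> by (intro mult_strict_mono') auto
    define s where "s = (\<Sum>n. q ^ n * \<beta> ^ n)"
    have "summable (\<lambda>n. q ^ n * \<beta> ^ n)"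
    proof (rule summable_comparison_test'[of _ 0])
      show "summable (\<lambda>n. (norm q * norm \<beta>) ^ n)" using qb by (intro summable_geometric) simp
      show "norm (q ^ n * \<beta> ^ n) \<le> (norm q * norm \<beta>) ^ n" for n
        by (simp add: norm_mult norm_power power_mult_distrib)
    qed
    then have s: "(\<lambda>n. q ^ n * \<beta> ^ n) sums s" unfolding s_def by (rule summable_sums)
    have "(\<lambda>n. q ^ Suc n * \<beta> ^ Suc n) sums (q * s * \<beta>)"
      using sums_mult2[OF sums_mult[OF s, of q], of \<beta>] by (simp add: mult.assoc power_commutes)
    then have "(\<lambda>n. q ^ n * \<beta> ^ n) sums (q * s * \<beta> + 1)"
      using sums_Suc[where f = "\<lambda>n. q ^ n * \<beta> ^ n"] by simp
    then have "q * s * \<beta> + 1 = s" using s by (rule sums_unique2)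
    then have s1: "s - q * s * \<beta> = 1" by (metis add_diff_cancel_left')
    define N where "N = reg_symm ?h q"
    have Ns: "N * s = 1 - q * qcnj \<beta>"
    proof -
      have "N * s = s - q * s * (\<beta> + qcnj \<beta>) + q * (q * s) * (\<beta> * qcnj \<beta>)"
        unfolding N_def symm quat_add_qcnj mult_qcnj
        by (simp add: of_real_def algebra_simps power2_eq_square)
      also have "\<dots> = (s - q * s * \<beta>) - q * (s - q * s * \<beta>) * qcnj \<beta>"
        by (simp add: algebra_simps)
      finally show ?thesis by (simp add: s1)
    qed
    have "norm (q * qcnj \<beta>) = norm q * norm \<beta>" by (simp add: norm_mult)
    then have "q * qcnj \<beta> \<noteq> 1" using qb by auto
    then have "N \<noteq> 0" using Ns by auto
    then have "inverse N * (1 - q * qcnj \<beta>) = s" unfolding Ns[symmetric] by (simp add: mult.assoc[symmetric])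
    then show "(\<lambda>n. q ^ n * \<beta> ^ n) sums reg_recip ?h q"
      using s by (simp add: reg_recip_def conj N_def)
  qed
qed

lemma quat_powser_mobius_product:
  assumes \<beta>: "norm \<beta> < 1"
  shows "quat_powser (\<lambda>n. if n = 0 then - qcnj \<beta> else (1 - (norm \<beta>)\<^sup>2) *\<^sub>R \<beta> ^ (n - 1))
    (reg_prod (reg_recip (\<lambda>p. 1 - p * \<beta>)) (\<lambda>p. p - qcnj \<beta>))"
proof -
  have cr: "slice_coeff (reg_recip (\<lambda>p. 1 - p * \<beta>)) = (\<lambda>n. \<beta> ^ n)"
    by (rule slice_coeff_eq[OF quat_powser_reg_recip[OF \<beta>]])
  have "quat_powser (\<lambda>n. if n = 0 then - qcnj \<beta> else if n = 1 then 1 else 0) (\<lambda>p. p - qcnj \<beta>)"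
    using quat_powser_linear[of "- qcnj \<beta>" 1] by simp
  then have cl: "slice_coeff (\<lambda>p. p - qcnj \<beta>) = (\<lambda>n. if n = 0 then - qcnj \<beta> else if n = 1 then 1 else 0)"
    by (rule slice_coeff_eq)
  let ?c = "\<lambda>n. if n = 0 then - qcnj \<beta> else (1 - (norm \<beta>)\<^sup>2) *\<^sub>R \<beta> ^ (n - 1)"
  have c: "(\<Sum>k\<le>n. \<beta> ^ k * (if n - k = 0 then - qcnj \<beta> else if n - k = 1 then 1 else 0)) = ?c n" for n
  proof (cases n)
    case (Suc m)
    have "(\<Sum>k\<le>n. \<beta> ^ k * (if n - k = 0 then - qcnj \<beta> else if n - k = 1 then 1 else 0))
        = \<beta> ^ Suc m * - qcnj \<beta> + (\<Sum>k\<le>m. \<beta> ^ k * (if k = m then 1 else 0))"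
      unfolding Suc by (simp add: Suc_diff_le cong: sum.cong) (rule sum.cong, auto)
    also have "(\<Sum>k\<le>m. \<beta> ^ k * (if k = m then 1 else 0)) = \<beta> ^ m"
      by (simp add: if_distrib[of "\<lambda>t. _ * t"] cong: if_cong)
    also have "\<beta> ^ Suc m * - qcnj \<beta> = - ((norm \<beta>)\<^sup>2 *\<^sub>R \<beta> ^ m)"
      unfolding power_Suc2 mult_minus_right mult.assoc mult_qcnj by simp
    finally show ?thesis by (simp add: Suc algebra_simps)
  qed simp
  show ?thesis
    unfolding quat_powser_def
  proof
    fix q :: quat assume "q \<in> ball 0 1"
    then have "norm q < 1" by simp
    from quat_powserD[OF quat_powser_reg_recip[OF \<beta>] this]
    have "summable (\<lambda>n. q ^ n * \<beta> ^ n)" by (simp add: sums_iff)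
    then have "summable (\<lambda>n. (1 - (norm \<beta>)\<^sup>2) *\<^sub>R (q * (q ^ n * \<beta> ^ n)))"
      by (intro summable_scaleR_right summable_mult)
    then have "summable (\<lambda>n. q ^ Suc n * ?c (Suc n))" by (simp add: mult.assoc)
    from iffD1[OF summable_Suc_iff[of "\<lambda>n. q ^ n * ?c n"] this]
    have "summable (\<lambda>n. q ^ n * ?c n)" .
    then show "(\<lambda>n. q ^ n * ?c n) sums reg_prod (reg_recip (\<lambda>p. 1 - p * \<beta>)) (\<lambda>p. p - qcnj \<beta>) q"
      unfolding reg_prod_def cr cl c by (rule summable_sums)
  qed
qed

text \<open>The function with parameters \<open>\<beta> = \<alpha> e\<^bsup>-I\<theta>\<^esup>\<close> and \<open>v\<close> has the normal form with \<open>\<eta> = \<beta> / \<alpha>\<close> and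
  \<open>W = \<eta>\<^sup>-\<^sup>2 v\<close>.\<close>

lemma quat_powser_extremal:
  assumes \<beta>: "norm \<beta> = \<alpha>" and \<alpha>: "0 < \<alpha>" "\<alpha> < 1"
  shows "quat_powser (\<lambda>n. mobius_coeff \<alpha> n *\<^sub>R ((\<beta> /\<^sub>R \<alpha>) ^ n * ((qcnj \<beta> /\<^sub>R \<alpha>)\<^sup>2 * v)))
    (\<lambda>q. q * reg_prod (reg_recip (\<lambda>p. 1 - p * \<beta>)) (\<lambda>p. p - qcnj \<beta>) q * v)"
  unfolding quat_powser_def
proof
  fix q :: quat assume "q \<in> ball 0 1"
  then have q: "norm q < 1" by simp
  let ?P = "reg_prod (reg_recip (\<lambda>p. 1 - p * \<beta>)) (\<lambda>p. p - qcnj \<beta>)"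
  let ?p = "\<lambda>n. if n = 0 then - qcnj \<beta> else (1 - (norm \<beta>)\<^sup>2) *\<^sub>R \<beta> ^ (n - 1)"
  let ?e = "\<lambda>n. mobius_coeff \<alpha> n *\<^sub>R ((\<beta> /\<^sub>R \<alpha>) ^ n * ((qcnj \<beta> /\<^sub>R \<alpha>)\<^sup>2 * v))"
  have \<beta>1: "\<beta> /\<^sub>R \<alpha> * (qcnj \<beta> /\<^sub>R \<alpha>) = 1"
  proof -
    have "inverse \<alpha> * (inverse \<alpha> * (\<alpha> * \<alpha>)) = 1" using \<alpha> by (simp add: field_simps)
    then show ?thesis by (simp add: mult_qcnj \<beta> power2_eq_square)
  qed
  have \<beta>2: "\<beta> /\<^sub>R \<alpha> * (qcnj \<beta> /\<^sub>R \<alpha> * u) = u" for u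
    by (simp only: mult.assoc[symmetric] \<beta>1 mult_1_left)
  have e: "?e (Suc n) = ?p n * v" for n
  proof (cases n)
    case 0
    have "?e (Suc 0) = - \<alpha> *\<^sub>R ((\<beta> /\<^sub>R \<alpha> * (qcnj \<beta> /\<^sub>R \<alpha>)) * (qcnj \<beta> /\<^sub>R \<alpha> * v))"
      by (simp only: mobius_coeff_simps power2_eq_square mult.assoc power_Suc power_0 mult_1_right mult_1_left)
    then show ?thesis using 0 \<alpha> unfolding \<beta>1 by simp
  next
    case (Suc k)
    have "?e (Suc n) = ((1 - \<alpha>\<^sup>2) * \<alpha> ^ k) *\<^sub>R ((\<beta> /\<^sub>R \<alpha>) ^ k *
        (\<beta> /\<^sub>R \<alpha> * ((\<beta> /\<^sub>R \<alpha> * (qcnj \<beta> /\<^sub>R \<alpha>)) * (qcnj \<beta> /\<^sub>R \<alpha> * v))))"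
      unfolding Suc mobius_coeff_simps power_Suc2 power2_eq_square by (simp only: mult.assoc)
    also have "\<dots> = ((1 - \<alpha>\<^sup>2) * \<alpha> ^ k) *\<^sub>R ((\<beta> /\<^sub>R \<alpha>) ^ k * ((\<beta> /\<^sub>R \<alpha> * (qcnj \<beta> /\<^sub>R \<alpha>)) * v))"
      by (simp only: \<beta>2 \<beta>1 mult_1_left)
    also have "\<dots> = (1 - \<alpha>\<^sup>2) *\<^sub>R (\<beta> ^ k * v)"
      unfolding \<beta>1 mult_1_left using \<alpha> by (simp add: scaleR_power power_inverse)
    finally show ?thesis using Suc \<beta> by simp
  qed
  have "(\<lambda>n. q * (q ^ n * ?p n) * v) sums (q * ?P q * v)"
    by (intro sums_mult2 sums_mult quat_powserD[OF quat_powser_mobius_product] q) (use \<beta> \<alpha> in simp)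
  then have "(\<lambda>n. q ^ Suc n * ?e (Suc n)) sums (q * ?P q * v)"
    unfolding e by (simp only: power_Suc mult.assoc)
  then show "(\<lambda>n. q ^ n * ?e n) sums (q * ?P q * v)"
    using sums_Suc[where f = "\<lambda>n. q ^ n * ?e n"] by simp
qed

lemma qcis_eq_slice_of: "qcis I \<theta> = slice_of I (cis \<theta>)"
  by (simp add: qcis_def slice_of_alt of_real_def)

lemma extremal_form_iff:
  assumes \<alpha>: "0 < \<alpha>" "\<alpha> < 1"
  shows "extremal_form \<alpha> f \<longleftrightarrow> (\<exists>\<eta> W. extremal_series \<alpha> f \<eta> W)"
proof -
  have form: "p * of_real \<alpha> * qcis I (- \<theta>) = p * (of_real \<alpha> * qcis I (- \<theta>))"
    "of_real \<alpha> * qcis I \<theta> = qcnj (of_real \<alpha> * qcis I (- \<theta>))"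
    "norm (of_real \<alpha> * qcis I (- \<theta>)) = \<alpha>" if "I \<in> imag_units" for p I \<theta>
  proof -
    have e: "of_real \<alpha> * qcis I t = slice_of I (of_real \<alpha> * cis t)" for t
      using that by (simp add: qcis_eq_slice_of slice_of_mult)
    show "of_real \<alpha> * qcis I \<theta> = qcnj (of_real \<alpha> * qcis I (- \<theta>))"
      unfolding e qcnj_slice_of[OF that] by (simp add: cis_cnj)
    show "norm (of_real \<alpha> * qcis I (- \<theta>)) = \<alpha>"
      unfolding e norm_slice_of[OF that] using \<alpha> by (simp add: norm_mult)
  qed (simp add: mult.assoc)
  show ?thesis
  proof
    assume "extremal_form \<alpha> f"
    then obtain I \<theta> v where I: "I \<in> imag_units" and v: "v \<in> frontier (ball 0 1)"
      and f: "\<forall>q\<in>ball 0 1. f q = q * reg_prod (reg_recip (\<lambda>p. 1 - p * of_real \<alpha> * qcis I (- \<theta>)))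
          (\<lambda>p. p - of_real \<alpha> * qcis I \<theta>) q * v"
      unfolding extremal_form_def by blast
    have v: "norm v = 1" using v by (simp add: frontier_ball)
    define \<beta> where "\<beta> = of_real \<alpha> * qcis I (- \<theta>)"
    have \<beta>: "norm \<beta> = \<alpha>" unfolding \<beta>_def by (rule form[OF I])
    have series: "quat_powser (\<lambda>n. mobius_coeff \<alpha> n *\<^sub>R ((\<beta> /\<^sub>R \<alpha>) ^ n * ((qcnj \<beta> /\<^sub>R \<alpha>)\<^sup>2 * v))) f"
      using quat_powser_extremal[OF \<beta> \<alpha>, of v] f
      unfolding quat_powser_def form(1)[OF I] form(2)[OF I, where \<theta> = \<theta>] \<beta>_def[symmetric] by simp
    have "extremal_series \<alpha> f (\<beta> /\<^sub>R \<alpha>) ((qcnj \<beta> /\<^sub>R \<alpha>)\<^sup>2 * v)"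
    proof -
      have "norm (\<beta> /\<^sub>R \<alpha>) = 1" "norm (qcnj \<beta> /\<^sub>R \<alpha>) = 1" using \<alpha> \<beta> by simp_all
      then show ?thesis
        using v series unfolding extremal_series_def by (simp only: norm_mult norm_power) simp
    qed
    then show "\<exists>\<eta> W. extremal_series \<alpha> f \<eta> W" by blast
  next
    assume "\<exists>\<eta> W. extremal_series \<alpha> f \<eta> W"
    then obtain \<eta> W where \<eta>: "norm \<eta> = 1" and W: "norm W = 1"
      and f: "quat_powser (\<lambda>n. mobius_coeff \<alpha> n *\<^sub>R (\<eta> ^ n * W)) f"
      unfolding extremal_series_def by blast
    obtain I z where I: "I \<in> imag_units" and \<eta>z: "\<eta> = slice_of I z" using quat_in_slice by blast
    have "cmod z = 1" using \<eta> I by (simp add: \<eta>z norm_slice_of)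
    then obtain \<theta>' where "z = cis \<theta>'" by (metis complex_unimodular_polar cis_conv_exp exp_Euler cis.ctr complex_eq_iff)
    \<comment> \<open>The parameters that invert the passage to the normal form: \<open>\<beta> = \<alpha> \<eta>\<close> and \<open>v = \<eta>\<^sup>2 W\<close>.\<close>
    define \<theta> where "\<theta> = - \<theta>'"
    define \<beta> where "\<beta> = of_real \<alpha> * qcis I (- \<theta>)"
    define v where "v = \<eta>\<^sup>2 * W"
    have \<beta>: "norm \<beta> = \<alpha>" unfolding \<beta>_def by (rule form[OF I])
    have "\<beta> = \<alpha> *\<^sub>R \<eta>"
      by (simp add: \<beta>_def \<theta>_def qcis_eq_slice_of \<eta>z \<open>z = cis \<theta>'\<close> scaleR_conv_of_real)
    then have \<eta>\<beta>: "\<beta> /\<^sub>R \<alpha> = \<eta>" "qcnj \<beta> /\<^sub>R \<alpha> = qcnj \<eta>"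
      using \<alpha> by (simp_all add: quat_eq_iff)
    have "(qcnj \<eta>)\<^sup>2 * v = qcnj \<eta> * ((qcnj \<eta> * \<eta>) * (\<eta> * W))"
      by (simp add: v_def power2_eq_square mult.assoc)
    also have "\<dots> = qcnj \<eta> * (\<eta> * W)" by (simp add: qcnj_mult_self \<eta>)
    also have "\<dots> = (qcnj \<eta> * \<eta>) * W" by (simp only: mult.assoc)
    finally have vW: "(qcnj \<eta>)\<^sup>2 * v = W" by (simp add: qcnj_mult_self \<eta>)
    have "f q = q * reg_prod (reg_recip (\<lambda>p. 1 - p * \<beta>)) (\<lambda>p. p - qcnj \<beta>) q * v" if "q \<in> ball 0 1" for q
      using quat_powser_extremal[OF \<beta> \<alpha>, of v] f that
      unfolding quat_powser_def \<eta>\<beta> vW by (blast intro: sums_unique2)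
    moreover have "v \<in> frontier (ball 0 1)" using \<eta> W by (simp add: v_def norm_mult norm_power frontier_ball)
    ultimately show "extremal_form \<alpha> f"
      unfolding extremal_form_def
      by (intro bexI[OF _ I] exI[of _ \<theta>] bexI[of _ v] ballI)
        (simp_all only: form(1)[OF I] form(2)[OF I, where \<theta> = \<theta>] \<beta>_def)
  qed
qed

section \<open>Growth of bounded slice regular functions\<close>

lemma deriv_powser_0:
  fixes F :: "complex \<Rightarrow> complex"
  assumes "\<And>z. cmod z < 1 \<Longrightarrow> (\<lambda>n. c n * z ^ n) sums F z"
  shows "deriv F 0 = c 1"
proof -
  have "F holomorphic_on ball 0 1"
    using assms by (intro power_series_holomorphic[where a = c]) simp
  then have "(F has_field_derivative deriv F 0) (at 0)"
    by (simp add: holomorphic_derivI)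
  from termdiffs_sums_strong[OF assms this, of 1] show ?thesis by (simp add: diffs_def)
qed

lemma mobius_rotation_unique:
  fixes \<mu> \<mu>' z :: complex
  assumes "0 < \<alpha>" "\<alpha> < 1" "z \<noteq> 0" "cmod z < 1" "cmod \<mu> = 1" "cmod \<mu>' = 1"
    and eq: "(of_real \<alpha> - \<mu> * z) / (1 - of_real \<alpha> * \<mu> * z) =
      (of_real \<alpha> - \<mu>' * z) / (1 - of_real \<alpha> * \<mu>' * z)"
  shows "\<mu> = \<mu>'"
proof -
  have nz: "1 - of_real \<alpha> * m * z \<noteq> 0" if "cmod m = 1" for m
    using disc_one_minus_mult_nonzero[of "of_real \<alpha>" "m * z"] assms that
    by (simp add: norm_mult mult.assoc)
  have "(of_real \<alpha> - \<mu> * z) * (1 - of_real \<alpha> * \<mu>' * z) = (of_real \<alpha> - \<mu>' * z) * (1 - of_real \<alpha> * \<mu> * z)"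
    using eq nz assms by (simp add: frac_eq_eq)
  then have "(\<mu> - \<mu>') * (z * (1 - (of_real \<alpha>)\<^sup>2)) = 0"
    by (simp add: algebra_simps power2_eq_square)
  moreover have "1 - (of_real \<alpha> :: complex)\<^sup>2 \<noteq> 0"
  proof -
    have "\<alpha>\<^sup>2 < 1" using assms by (simp add: power_less_one_iff abs_square_less_1)
    then have "1 - \<alpha>\<^sup>2 \<noteq> 0" by simp
    then show ?thesis by (metis of_real_1 of_real_diff of_real_eq_0_iff of_real_power)
  qed
  ultimately show ?thesis using assms by simp
qed

text \<open>A member \<open>f\<close> of the class, given with its power series: the slice derivative at 0 is \<open>a 1\<close>.\<close>

locale bounded_quat_powser =
  fixes f :: "quat \<Rightarrow> quat" and a :: "nat \<Rightarrow> quat" and \<alpha> :: real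
  assumes powser: "quat_powser a f"
    and bounded: "\<And>q. norm q < 1 \<Longrightarrow> norm (f q) < 1"
    and zero: "f 0 = 0"
    and norm_a1: "norm (a 1) = \<alpha>" and \<alpha>: "0 < \<alpha>" "\<alpha> < 1"
begin

text \<open>A right factor \<open>v\<close> makes the derivative at 0 equal to \<open>\<alpha>\<close>; the slice part of \<open>f * v\<close> then
  satisfies the hypotheses of the complex growth estimate on every slice.\<close>

lemma normalised_slice:
  obtains v where "norm v = 1" "quat_powser (\<lambda>n. a n * v) (\<lambda>q. f q * v)" "a 1 * v = of_real \<alpha>"
    "\<And>I. I \<in> imag_units \<Longrightarrow> (\<lambda>z. slice_part I (f (slice_of I z) * v)) holomorphic_on ball 0 1"
    "\<And>I. I \<in> imag_units \<Longrightarrow> deriv (\<lambda>z. slice_part I (f (slice_of I z) * v)) 0 = of_real \<alpha>"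
proof -
  define v where "v = inverse (a 1) * of_real \<alpha>"
  have a1: "a 1 \<noteq> 0" using norm_a1 \<alpha> by auto
  have v: "norm v = 1" using norm_a1 \<alpha> by (simp add: v_def norm_mult norm_inverse)
  have ps: "quat_powser (\<lambda>n. a n * v) (\<lambda>q. f q * v)" by (rule quat_powser_mult_right[OF powser])
  have av: "a 1 * v = of_real \<alpha>" using a1 by (simp add: v_def mult.assoc[symmetric])
  have "deriv (\<lambda>z. slice_part I (f (slice_of I z) * v)) 0 = of_real \<alpha>" if I: "I \<in> imag_units" for I
    using deriv_powser_0[OF slice_part_sums[OF ps I]] av I by simp
  then show ?thesis using that[OF v ps av] holomorphic_slice_part[OF ps] by blast
qed

lemma growth:
  assumes q: "norm q < 1"
  shows "norm q * ((\<alpha> - norm q) / (1 - \<alpha> * norm q)) \<le> norm (f q)"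
proof -
  obtain v where v: "norm v = 1"
    and hol: "\<And>I. I \<in> imag_units \<Longrightarrow> (\<lambda>z. slice_part I (f (slice_of I z) * v)) holomorphic_on ball 0 1"
    and der: "\<And>I. I \<in> imag_units \<Longrightarrow> deriv (\<lambda>z. slice_part I (f (slice_of I z) * v)) 0 = of_real \<alpha>"
    using normalised_slice by metis
  obtain I z where I: "I \<in> imag_units" and qz: "q = slice_of I z" using quat_in_slice by blast
  have le: "cmod (slice_part I (f (slice_of I w) * v)) \<le> norm (f (slice_of I w))" for w
    using cmod_slice_part_le[OF I, of "f (slice_of I w) * v"] v by (simp add: norm_mult)
  have lt: "cmod (slice_part I (f (slice_of I w) * v)) < 1" if "cmod w < 1" for w
    using le[of w] bounded[of "slice_of I w"] that by (simp add: norm_slice_of[OF I])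
  have "cmod z * ((\<alpha> - cmod z) / (1 - \<alpha> * cmod z)) \<le> cmod (slice_part I (f (slice_of I z) * v))"
    by (rule Landau_growth(1)[OF hol[OF I] _ lt der[OF I] \<alpha>])
      (use q in \<open>simp_all add: zero qz norm_slice_of[OF I]\<close>)
  then show ?thesis using le[of z] by (simp add: qz norm_slice_of[OF I])
qed

text \<open>Equality at a point of the slice of \<open>I\<close> forces the slice part \<open>F\<close> of \<open>f * v\<close> to be a Blaschke
  product and the complementary part \<open>G\<close> to vanish on that slice. Hence the coefficients of \<open>f * v\<close>
  lie in the slice and are those of \<open>F\<close>.\<close>

lemma growth_equality:
  assumes q: "q \<noteq> 0" "norm q < \<alpha>"
    and eq: "norm (f q) = norm q * ((\<alpha> - norm q) / (1 - \<alpha> * norm q))"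
  shows "\<exists>\<eta> W. extremal_series \<alpha> f \<eta> W"
proof -
  obtain v where v: "norm v = 1" and ps: "quat_powser (\<lambda>n. a n * v) (\<lambda>q. f q * v)"
    and av: "a 1 * v = of_real \<alpha>"
    and hol: "\<And>I. I \<in> imag_units \<Longrightarrow> (\<lambda>z. slice_part I (f (slice_of I z) * v)) holomorphic_on ball 0 1"
    and der: "\<And>I. I \<in> imag_units \<Longrightarrow> deriv (\<lambda>z. slice_part I (f (slice_of I z) * v)) 0 = of_real \<alpha>"
    using normalised_slice by metis
  obtain I z0 where I: "I \<in> imag_units" and qz: "q = slice_of I z0" using quat_in_slice by blast
  obtain J where J: "J \<in> imag_units" and IJ: "I * J = - (J * I)" using imag_units_anticommuting[OF I] by blast
  have z0: "z0 \<noteq> 0" "cmod z0 < \<alpha>" "cmod z0 < 1" using q \<alpha> by (auto simp: qz norm_slice_of[OF I])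
  define F where "F z = slice_part I (f (slice_of I z) * v)" for z
  define G where "G z = slice_part I (f (slice_of I z) * v * - J)" for z
  have FG: "(norm (f (slice_of I z)))\<^sup>2 = (cmod (F z))\<^sup>2 + (cmod (G z))\<^sup>2" for z
    using norm_slice_decomposition[OF I J IJ, of "f (slice_of I z) * v"] v
    by (simp add: F_def G_def norm_mult)
  have FG1: "(cmod (F z))\<^sup>2 + (cmod (G z))\<^sup>2 < 1" if "cmod z < 1" for z
    unfolding FG[symmetric] using bounded[of "slice_of I z"] that
    by (simp add: norm_slice_of[OF I] abs_square_less_1)
  have holF: "F holomorphic_on ball 0 1" unfolding F_def by (rule hol[OF I])
  have holG: "G holomorphic_on ball 0 1"
    unfolding G_def by (rule holomorphic_slice_part[OF quat_powser_mult_right[OF ps] I])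
  have F0: "F 0 = 0" and G0: "G 0 = 0" by (simp_all add: F_def G_def zero)
  have Fb: "cmod (F z) < 1" if "cmod z < 1" for z
    using FG1[OF that] by (smt (verit) norm_ge_zero power2_less_imp_less one_power2 zero_le_power2)
  define r where "r = cmod z0 * ((\<alpha> - cmod z0) / (1 - \<alpha> * cmod z0))"
  have r: "norm (f (slice_of I z0)) = r" using eq by (simp add: r_def qz norm_slice_of[OF I])
  have rF: "r \<le> cmod (F z0)"
    unfolding r_def by (rule Landau_growth(1)[OF holF F0 Fb _ \<alpha> z0(3)]) (use der[OF I] in \<open>auto simp: F_def\<close>)
  have r0: "0 \<le> r" using r norm_ge_zero by metis
  have "r\<^sup>2 \<le> (cmod (F z0))\<^sup>2" using rF r0 by (intro power_mono) auto
  then have Gz0: "G z0 = 0" and Fr2: "(cmod (F z0))\<^sup>2 = r\<^sup>2"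
    using FG[of z0] by (auto simp: r add_nonneg_eq_0_iff)
  have Fr: "cmod (F z0) = r" using Fr2 r0 by (simp add: power2_eq_iff_nonneg)
  \<comment> \<open>Since \<open>\<bar>F\<bar>\<^sup>2 + \<bar>G\<bar>\<^sup>2 < 1\<close>, also \<open>\<bar>F\<bar> + \<bar>G\<bar>\<^sup>2 / 2 < 1\<close>. So \<open>H\<close> is subject to the same growth estimate,
    with equality at the same point; this forces \<open>H = F\<close> and thus \<open>G = 0\<close>.\<close>
  define H where "H z = F z + (G z)\<^sup>2 / 2" for z
  have holH: "H holomorphic_on ball 0 1" unfolding H_def by (intro holomorphic_intros holF holG) auto
  have H0: "H 0 = 0" by (simp add: H_def F0 G0)
  have Hb: "cmod (H z) < 1" if "cmod z < 1" for z
  proof -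
    define s where "s = cmod (F z)"
    have "cmod (H z) \<le> s + (cmod (G z))\<^sup>2 / 2"
      unfolding H_def s_def using norm_triangle_ineq[of "F z" "(G z)\<^sup>2 / 2"] by (simp add: norm_divide norm_power)
    also have "\<dots> < s + (1 - s\<^sup>2) / 2" using FG1[OF that] by (simp add: s_def)
    also have "\<dots> = 1 - (1 - s)\<^sup>2 / 2" by (simp add: power2_eq_square field_simps)
    also have "\<dots> \<le> 1" by simp
    finally show ?thesis .
  qed
  have derF: "deriv F 0 = of_real \<alpha>" unfolding F_def by (rule der[OF I])
  have derH: "deriv H 0 = of_real \<alpha>"
  proof -
    have "(F has_field_derivative of_real \<alpha>) (at 0)"
      using holomorphic_derivI[OF holF, of 0] derF by simp
    moreover have "(G has_field_derivative deriv G 0) (at 0)"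
      using holomorphic_derivI[OF holG, of 0] by simp
    ultimately have "(H has_field_derivative of_real \<alpha>) (at 0)"
      unfolding H_def by (auto intro!: derivative_eq_intros simp: G0)
    then show ?thesis by (rule DERIV_imp_deriv)
  qed
  obtain \<mu> where \<mu>: "cmod \<mu> = 1"
    and F: "\<And>z. cmod z < 1 \<Longrightarrow> F z = z * ((of_real \<alpha> - \<mu> * z) / (1 - of_real \<alpha> * \<mu> * z))"
    using Landau_growth(2)[OF holF F0 Fb derF \<alpha> z0(1,2)] Fr by (auto simp: r_def)
  obtain \<mu>' where \<mu>': "cmod \<mu>' = 1"
    and H: "\<And>z. cmod z < 1 \<Longrightarrow> H z = z * ((of_real \<alpha> - \<mu>' * z) / (1 - of_real \<alpha> * \<mu>' * z))"
    using Landau_growth(2)[OF holH H0 Hb derH \<alpha> z0(1,2)] Fr Gz0 by (auto simp: r_def H_def)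
  have "F z0 = H z0" by (simp add: H_def Gz0)
  then have "(of_real \<alpha> - \<mu> * z0) / (1 - of_real \<alpha> * \<mu> * z0) =
      (of_real \<alpha> - \<mu>' * z0) / (1 - of_real \<alpha> * \<mu>' * z0)"
    unfolding F[OF z0(3)] H[OF z0(3)] mult_cancel_left using z0(1) by simp
  then have "\<mu> = \<mu>'" by (rule mobius_rotation_unique[OF \<alpha> z0(1,3) \<mu> \<mu>'])
  then have G: "G z = 0" if "cmod z < 1" for z
    using F[OF that] H[OF that] by (simp add: H_def)
  have fF: "f (slice_of I z) * v = slice_of I (F z)" if "cmod z < 1" for z
    using slice_decomposition[OF I J IJ, of "f (slice_of I z) * v"] G[OF that] by (simp add: F_def G_def)
  have Fsums: "(\<lambda>n. - cnj \<mu> * (of_real (mobius_coeff \<alpha> n) * (\<mu> * z) ^ n)) sums F z" if z: "cmod z < 1" for z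
  proof -
    have "cnj \<mu> * \<mu> = 1" using \<mu> complex_norm_square[of \<mu>] by (simp add: mult.commute)
    then have "- cnj \<mu> * (\<mu> * z * ((\<mu> * z - of_real \<alpha>) / (1 - of_real \<alpha> * (\<mu> * z)))) = F z"
    proof -
      have "(\<mu> * z - of_real \<alpha>) / (1 - of_real \<alpha> * (\<mu> * z)) =
          - ((of_real \<alpha> - \<mu> * z) / (1 - of_real \<alpha> * \<mu> * z))"
        unfolding minus_divide_left minus_diff_eq mult.assoc ..
      moreover have "- cnj \<mu> * (\<mu> * z * - X) = (cnj \<mu> * \<mu>) * (z * X)" for X
        by (simp only: minus_mult_minus mult_minus_left mult_minus_right minus_minus mult.assoc)
      ultimately show ?thesis using \<open>cnj \<mu> * \<mu> = 1\<close> by (simp only: F[OF z] mult_1_left)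
    qed
    moreover have "norm (\<mu> * z) < 1" using z \<mu> by (simp add: norm_mult)
    ultimately show ?thesis using sums_mult[OF mobius_series[OF \<alpha>], of "\<mu> * z" "- cnj \<mu>"] by simp
  qed
  define \<eta> where "\<eta> = slice_of I \<mu>"
  define W where "W = - slice_of I (cnj \<mu>) * inverse v"
  have "(\<lambda>n. a n * v) = (\<lambda>n. slice_of I (- cnj \<mu> * of_real (mobius_coeff \<alpha> n) * \<mu> ^ n))"
  proof (rule quat_powser_real_unique)
    fix x :: real assume x: "\<bar>x\<bar> < 1"
    show "(\<lambda>n. of_real x ^ n * (a n * v)) sums (f (of_real x) * v)"
      using quat_powserD[OF ps, of "of_real x"] x by simp
    have "(\<lambda>n. slice_of I (- cnj \<mu> * (of_real (mobius_coeff \<alpha> n) * (\<mu> * of_real x) ^ n)))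
        sums (f (of_real x) * v)"
      using bounded_linear.sums[OF bounded_linear_slice_of Fsums[of "of_real x"]] fF[of "of_real x"] x
      by simp
    moreover have "slice_of I (- cnj \<mu> * (of_real (mobius_coeff \<alpha> n) * (\<mu> * of_real x) ^ n)) =
        of_real x ^ n * slice_of I (- cnj \<mu> * of_real (mobius_coeff \<alpha> n) * \<mu> ^ n)" for n
    proof -
      have "- cnj \<mu> * (of_real (mobius_coeff \<alpha> n) * (\<mu> * of_real x) ^ n)
          = of_real x ^ n * (- cnj \<mu> * of_real (mobius_coeff \<alpha> n) * \<mu> ^ n)"
        by (simp add: power_mult_distrib mult_ac)
      then show ?thesis by (simp only: slice_of_mult[OF I] slice_of_power[OF I] slice_of_of_real)
    qed
    ultimately show "(\<lambda>n. of_real x ^ n * slice_of I (- cnj \<mu> * of_real (mobius_coeff \<alpha> n) * \<mu> ^ n))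
        sums (f (of_real x) * v)" by simp
  qed
  then have avn: "a n * v = slice_of I (- cnj \<mu> * of_real (mobius_coeff \<alpha> n) * \<mu> ^ n)" for n
    by (rule fun_cong)
  have "a n = mobius_coeff \<alpha> n *\<^sub>R (\<eta> ^ n * W)" for n
  proof -
    have "v \<noteq> 0" using v by auto
    then have "a n = a n * v * inverse v" by (simp add: mult.assoc)
    also have "a n * v = mobius_coeff \<alpha> n *\<^sub>R (\<eta> ^ n * - slice_of I (cnj \<mu>))"
    proof -
      have "- cnj \<mu> * of_real (mobius_coeff \<alpha> n) * \<mu> ^ n = of_real (mobius_coeff \<alpha> n) * (\<mu> ^ n * - cnj \<mu>)"
        by (simp add: mult_ac)
      then show ?thesis
        unfolding avn \<eta>_def scaleR_conv_of_real slice_of_minus[symmetric]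
        by (simp only: slice_of_mult[OF I] slice_of_power[OF I] slice_of_of_real)
    qed
    finally show ?thesis by (simp add: W_def mult.assoc)
  qed
  then have "a = (\<lambda>n. mobius_coeff \<alpha> n *\<^sub>R (\<eta> ^ n * W))" by (rule ext)
  then have "quat_powser (\<lambda>n. mobius_coeff \<alpha> n *\<^sub>R (\<eta> ^ n * W)) f" using powser by simp
  moreover have "norm \<eta> = 1" "norm W = 1"
    using \<mu> v by (simp_all add: \<eta>_def W_def norm_mult norm_inverse norm_slice_of[OF I])
  ultimately show ?thesis unfolding extremal_series_def by blast
qed

end

section \<open>Injectivity and covering\<close>

text \<open>The fixed point of \<open>mob \<alpha>\<close> in the unit interval.\<close>

definition landau_radius :: "real \<Rightarrow> real" where
  "landau_radius \<alpha> = \<alpha> / (1 + sqrt (1 - \<alpha>\<^sup>2))"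

lemma mob_involution:
  assumes "0 < \<alpha>" "\<alpha> < 1" "\<bar>x\<bar> < 1"
  shows "mob \<alpha> (mob \<alpha> x) = x"
proof -
  have p: "1 - \<alpha> * x \<noteq> 0" using mob_denominator_pos[OF assms] by simp
  have "\<alpha>\<^sup>2 < 1" using assms by (simp add: power_less_one_iff abs_square_less_1)
  then have a: "1 - \<alpha>\<^sup>2 \<noteq> 0" by simp
  have "\<alpha> - mob \<alpha> x = (1 - \<alpha>\<^sup>2) * x / (1 - \<alpha> * x)" "1 - \<alpha> * mob \<alpha> x = (1 - \<alpha>\<^sup>2) / (1 - \<alpha> * x)"
    using p by (simp_all add: mob_def field_simps power2_eq_square)
  then show ?thesis unfolding mob_def[of _ "mob \<alpha> x"] using p a by simp
qed

lemma landau_radius_fixed_point: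
  assumes "0 < \<alpha>" "\<alpha> < 1"
  shows "0 < landau_radius \<alpha>" "landau_radius \<alpha> < \<alpha>" "mob \<alpha> (landau_radius \<alpha>) = landau_radius \<alpha>"
proof -
  define s where "s = sqrt (1 - \<alpha>\<^sup>2)"
  have "\<alpha>\<^sup>2 < 1" using assms by (simp add: power_less_one_iff abs_square_less_1)
  then have s: "0 < s" "s\<^sup>2 = 1 - \<alpha>\<^sup>2" by (simp_all add: s_def)
  let ?\<rho> = "landau_radius \<alpha>"
  have \<rho>: "?\<rho> = \<alpha> / (1 + s)" by (simp add: landau_radius_def s_def)
  show pos: "0 < ?\<rho>" unfolding \<rho> using assms s by simp
  show lt: "?\<rho> < \<alpha>" unfolding \<rho> using assms s by (simp add: divide_less_eq)
  have "\<alpha> * ?\<rho> = 1 - s"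
  proof -
    have "\<alpha> * \<alpha> = (1 - s) * (1 + s)" using s by (simp add: power2_eq_square algebra_simps)
    then show ?thesis unfolding \<rho> using s by (simp add: field_simps)
  qed
  then have "(1 - \<alpha> * ?\<rho>) * ?\<rho> = s * ?\<rho>" "0 < 1 - \<alpha> * ?\<rho>" using s by simp_all
  moreover have "s * ?\<rho> = \<alpha> - ?\<rho>" unfolding \<rho> using s by (simp add: field_simps)
  ultimately show "mob \<alpha> ?\<rho> = ?\<rho>" by (simp add: mob_def field_simps)
qed

lemma mob_gt_landau_radius:
  assumes "0 < \<alpha>" "\<alpha> < 1" "0 \<le> x" "x < landau_radius \<alpha>"
  shows "landau_radius \<alpha> < mob \<alpha> x"
  using mob_strict_antimono[OF assms(1-4)] landau_radius_fixed_point[OF assms(1,2)] assms(2) by simp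

lemma mult_mob_strict_mono:
  assumes \<alpha>: "0 < \<alpha>" "\<alpha> < 1" and x: "0 \<le> x" "x < r" "r \<le> landau_radius \<alpha>"
  shows "x * mob \<alpha> x < r * mob \<alpha> r"
proof -
  have p: "0 < 1 - \<alpha> * x" "0 < 1 - \<alpha> * r"
    using mob_denominator_pos[OF \<alpha>, of x] mob_denominator_pos[OF \<alpha>, of r] x landau_radius_fixed_point[OF \<alpha>] \<alpha> by auto
  have "r < mob \<alpha> x" using mob_gt_landau_radius[OF \<alpha>, of x] x by simp
  then have "0 < \<alpha> - x - r * (1 - \<alpha> * x)" using p by (simp add: mob_def less_divide_eq)
  then have "0 < (r - x) * (\<alpha> - x - r * (1 - \<alpha> * x))" using x by simp
  also have "\<dots> = r * (\<alpha> - r) * (1 - \<alpha> * x) - x * (\<alpha> - x) * (1 - \<alpha> * r)"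
    by (simp add: algebra_simps)
  finally show ?thesis unfolding mob_def using p by (simp add: field_simps)
qed

lemma cover_radius_eq: "cover_radius \<alpha> r = r * mob \<alpha> r"
  by (simp add: cover_radius_def mob_def)

context bounded_quat_powser
begin

text \<open>The growth estimate at \<open>q1\<close> and the bound \<open>norm (f q1) \<le> norm q1 * norm q2\<close>, combined. Since \<open>mob \<alpha>\<close>
  decreases through its fixed point, two points with the same value cannot both lie in the ball of
  radius \<open>landau_radius \<alpha>\<close>.\<close>

lemma mob_le_of_double_value:
  assumes q: "norm q1 < 1" "norm q2 < 1" "q1 \<noteq> q2" "f q1 = f q2"
  shows "mob \<alpha> (norm q1) \<le> norm q2"
proof (cases "q1 = 0")
  case True
  then have "norm q2 * mob \<alpha> (norm q2) \<le> 0" "norm q2 > 0"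
    using growth[OF q(2)] q zero by (simp_all add: mob_def)
  then have "mob \<alpha> (norm q2) \<le> 0" by (simp add: mult_le_0_iff)
  then have "\<alpha> \<le> norm q2" using mob_denominator_pos[OF \<alpha>, of "norm q2"] q
    by (simp add: mob_def divide_le_0_iff)
  then show ?thesis using True by (simp add: mob_def)
next
  case False
  have "norm q1 * mob \<alpha> (norm q1) \<le> norm (f q1)" using growth[OF q(1)] by (simp add: mob_def)
  also have "\<dots> \<le> norm q1 * norm q2" by (rule double_value_bound[OF powser bounded zero q])
  finally show ?thesis using False by (simp add: mult_le_cancel_left)
qed

lemma inj_on_landau_ball:
  assumes "r \<le> landau_radius \<alpha>"
  shows "inj_on f (ball 0 r)"
proof (rule inj_onI, rule ccontr)
  fix q1 q2 assume q: "q1 \<in> ball 0 r" "q2 \<in> ball 0 r" "f q1 = f q2" "q1 \<noteq> q2"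
  have "mob \<alpha> (norm q1) \<le> norm q2"
    using q assms landau_radius_fixed_point[OF \<alpha>] \<alpha> by (intro mob_le_of_double_value) auto
  moreover have "landau_radius \<alpha> < mob \<alpha> (norm q1)"
    using q assms by (intro mob_gt_landau_radius \<alpha>) auto
  ultimately show False using q assms by simp
qed

lemma continuous_f: "continuous_on (ball 0 1) f"
  by (rule quat_powser_continuous_on[OF powser])

text \<open>Take pairs of distinct points with equal values in balls shrinking to the ball of radius
  \<open>landau_radius \<alpha>\<close>. A limit point \<open>l\<close> of the first members lies on its boundary and satisfies the
  growth estimate with equality. It does not matter whether the two points of a pair merge in the
  limit.\<close>

lemma extremal_of_not_inj:
  assumes ninj: "\<And>r. landau_radius \<alpha> < r \<Longrightarrow> r \<le> 1 \<Longrightarrow> \<not> inj_on f (ball 0 r)"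
  shows "\<exists>\<eta> W. extremal_series \<alpha> f \<eta> W"
proof -
  define \<rho> where "\<rho> = landau_radius \<alpha>"
  have \<rho>: "0 < \<rho>" "\<rho> < \<alpha>" "mob \<alpha> \<rho> = \<rho>" using landau_radius_fixed_point[OF \<alpha>] by (simp_all add: \<rho>_def)
  define r where "r n = \<rho> + (1 - \<rho>) / 2 / real (Suc n)" for n
  have rb: "\<rho> < r n" "r n \<le> (1 + \<rho>) / 2" for n
  proof -
    show "\<rho> < r n" using \<rho> \<alpha> by (simp add: r_def)
    have "(1 - \<rho>) / 2 / real (Suc n) \<le> (1 - \<rho>) / 2 / 1"
      using \<rho> \<alpha> by (intro divide_left_mono) auto
    then show "r n \<le> (1 + \<rho>) / 2" by (simp add: r_def field_simps)
  qed
  have r1: "(1 + \<rho>) / 2 < 1" using \<rho> \<alpha> by simp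
  have rlim: "r \<longlonglongrightarrow> \<rho>"
  proof -
    have "(\<lambda>n. \<rho> + (1 - \<rho>) / 2 / real (Suc n)) \<longlonglongrightarrow> \<rho> + 0"
      by (intro tendsto_add tendsto_const LIMSEQ_Suc lim_const_over_n)
    then show ?thesis by (simp add: r_def[abs_def])
  qed
  have "\<exists>p q. p \<in> ball 0 (r n) \<and> q \<in> ball 0 (r n) \<and> p \<noteq> q \<and> f p = f q" for n
    using ninj[of "r n"] rb[of n] r1 unfolding \<rho>_def inj_on_def by fastforce
  then obtain p q where pq: "\<And>n. p n \<in> ball 0 (r n)" "\<And>n. q n \<in> ball 0 (r n)" "\<And>n. p n \<noteq> q n" "\<And>n. f (p n) = f (q n)"
    by metis
  have n1: "norm (p n) < 1" "norm (q n) < 1" for n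
    using pq(1,2)[of n] rb(2)[of n] r1 by auto
  have "\<forall>n. p n \<in> cball 0 ((1 + \<rho>) / 2)"
  proof
    fix n
    have "norm (p n) < (1 + \<rho>) / 2" using pq(1)[of n] rb(2)[of n] by simp
    then show "p n \<in> cball 0 ((1 + \<rho>) / 2)" by simp
  qed
  then obtain l s where l: "l \<in> cball 0 ((1 + \<rho>) / 2)" and s: "strict_mono s" and lim: "(p \<circ> s) \<longlonglongrightarrow> l"
    using compact_cball[of 0 "(1 + \<rho>) / 2"] unfolding compact_def by metis
  have lim: "(\<lambda>n. p (s n)) \<longlonglongrightarrow> l" using lim by (simp add: o_def)
  have l1: "norm l < 1" using l r1 by simp
  have rs: "(\<lambda>n. r (s n)) \<longlonglongrightarrow> \<rho>" using LIMSEQ_subseq_LIMSEQ[OF rlim s] by (simp add: o_def)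
  have normlim: "(\<lambda>n. norm (p (s n))) \<longlonglongrightarrow> norm l" using lim by (rule tendsto_norm)
  have l\<rho>: "norm l \<le> \<rho>"
    by (rule LIMSEQ_le[OF normlim rs]) (use pq(1) in \<open>auto intro: less_imp_le\<close>)
  have moblim: "(\<lambda>n. mob \<alpha> (norm (p (s n)))) \<longlonglongrightarrow> mob \<alpha> (norm l)"
    unfolding mob_def using mob_denominator_pos[OF \<alpha>, of "norm l"] l1
    by (intro tendsto_intros normlim) auto
  have "mob \<alpha> (norm l) \<le> \<rho>"
  proof (rule LIMSEQ_le[OF moblim rs], intro exI allI impI)
    fix n
    show "mob \<alpha> (norm (p (s n))) \<le> r (s n)"
      using mob_le_of_double_value[OF n1(1) n1(2) pq(3,4), of "s n"] pq(2)[of "s n"] by simp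
  qed
  then have "\<not> norm l < \<rho>" using mob_gt_landau_radius[OF \<alpha>, of "norm l"] by (auto simp: \<rho>_def)
  then have nl: "norm l = \<rho>" using l\<rho> by simp
  have "isCont f l" using continuous_f l1 by (simp add: continuous_on_eq_continuous_at)
  then have "(\<lambda>n. f (p (s n))) \<longlonglongrightarrow> f l" using lim by (rule isCont_tendsto_compose)
  then have flim: "(\<lambda>n. norm (f (p (s n)))) \<longlonglongrightarrow> norm (f l)" by (rule tendsto_norm)
  have "norm (f l) \<le> norm l * \<rho>"
  proof (rule LIMSEQ_le[OF flim tendsto_mult[OF normlim rs]], intro exI allI impI)
    fix n
    have "norm (f (p (s n))) \<le> norm (p (s n)) * norm (q (s n))"
      by (rule double_value_bound[OF powser bounded zero n1 pq(3,4)])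
    also have "\<dots> \<le> norm (p (s n)) * r (s n)"
      using pq(2)[of "s n"] by (intro mult_left_mono) auto
    finally show "norm (f (p (s n))) \<le> norm (p (s n)) * r (s n)" .
  qed
  moreover have "norm l * mob \<alpha> (norm l) \<le> norm (f l)" using growth[OF l1] by (simp add: mob_def)
  ultimately have "norm (f l) = norm l * mob \<alpha> (norm l)" using nl \<rho>(3) by simp
  moreover have "l \<noteq> 0" "norm l < \<alpha>" using nl \<rho> by auto
  ultimately show ?thesis by (intro growth_equality) (simp_all add: mob_def)
qed

text \<open>The map \<open>x \<mapsto> x * mob \<alpha> x\<close> is invariant under \<open>x \<mapsto> mob \<alpha> x\<close>, which exchanges points just below
  and just above \<open>landau_radius \<alpha>\<close>.\<close>

lemma extremal_not_inj:
  assumes f: "extremal_series \<alpha> f \<eta> W" and r: "landau_radius \<alpha> < r"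
  shows "\<not> inj_on f (ball 0 r)"
proof
  assume inj: "inj_on f (ball 0 r)"
  \<comment> \<open>\<open>t < \<alpha>\<close> makes \<open>mob \<alpha> t\<close> positive.\<close>
  obtain t where t: "landau_radius \<alpha> < t" "t < min r \<alpha>"
    using dense[of "landau_radius \<alpha>" "min r \<alpha>"] r landau_radius_fixed_point[OF \<alpha>] by auto
  define x where "x = mob \<alpha> t"
  have t1: "0 < t" "t < 1" "\<bar>t\<bar> < 1" using t landau_radius_fixed_point[OF \<alpha>] \<alpha> by auto
  have "x < landau_radius \<alpha>"
    using mob_strict_antimono[OF \<alpha> _ t(1) t1(2)] landau_radius_fixed_point[OF \<alpha>] by (simp add: x_def)
  moreover have "0 < x"
    unfolding x_def mob_def using t mob_denominator_pos[OF \<alpha> t1(3)] by (intro divide_pos_pos) auto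
  ultimately have x: "0 < x" "x < t" "\<bar>x\<bar> < 1" using t t1 by auto
  have mx: "mob \<alpha> x = t" unfolding x_def by (rule mob_involution[OF \<alpha> t1(3)])
  have \<eta>: "norm (inverse \<eta>) = 1" using f by (simp add: extremal_series_def norm_inverse)
  have v: "f (y *\<^sub>R inverse \<eta>) = (- (y * mob \<alpha> y)) *\<^sub>R W" if "\<bar>y\<bar> < 1" for y
  proof -
    have "y * ((y - \<alpha>) / (1 - \<alpha> * y)) = - (y * mob \<alpha> y)"
      unfolding mob_def by (simp add: minus_divide_left algebra_simps)
    then show ?thesis using extremal_series_value[OF f \<alpha> that] by simp
  qed
  have "f (x *\<^sub>R inverse \<eta>) = f (t *\<^sub>R inverse \<eta>)"
    unfolding v[OF x(3)] v[OF t1(3)] mx x_def[symmetric] by (simp add: mult.commute)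
  moreover have "x *\<^sub>R inverse \<eta> \<in> ball 0 r" "t *\<^sub>R inverse \<eta> \<in> ball 0 r"
    using x t t1 \<eta> by auto
  ultimately have "x *\<^sub>R inverse \<eta> = t *\<^sub>R inverse \<eta>" using inj by (simp add: inj_on_eq_iff)
  moreover have "inverse \<eta> \<noteq> 0" using \<eta> by (metis norm_zero zero_neq_one)
  ultimately show False using x by (simp only: scaleR_cancel_right) simp
qed

lemma inj_radius_ge: "landau_radius \<alpha> \<le> inj_radius f"
  unfolding inj_radius_def using inj_on_landau_ball[of "landau_radius \<alpha>"] landau_radius_fixed_point[OF \<alpha>] \<alpha>
  by (intro cSup_upper) (auto intro: bdd_aboveI[of _ 1])

lemma inj_radius_eq_iff: "inj_radius f = landau_radius \<alpha> \<longleftrightarrow> extremal_form \<alpha> f"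
  unfolding extremal_form_iff[OF \<alpha>]
proof
  assume eq: "inj_radius f = landau_radius \<alpha>"
  show "\<exists>\<eta> W. extremal_series \<alpha> f \<eta> W"
  proof (rule extremal_of_not_inj)
    fix r assume r: "landau_radius \<alpha> < r" "r \<le> 1"
    show "\<not> inj_on f (ball 0 r)"
    proof
      assume "inj_on f (ball 0 r)"
      then have "r \<le> inj_radius f"
        unfolding inj_radius_def using r landau_radius_fixed_point[OF \<alpha>]
        by (intro cSup_upper) (auto intro: bdd_aboveI[of _ 1])
      then show False using eq r by simp
    qed
  qed
next
  assume "\<exists>\<eta> W. extremal_series \<alpha> f \<eta> W"
  then obtain \<eta> W where e: "extremal_series \<alpha> f \<eta> W" by blast
  have "inj_radius f \<le> landau_radius \<alpha>"
    unfolding inj_radius_def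
  proof (rule cSup_least)
    show "{r. 0 \<le> r \<and> r \<le> 1 \<and> inj_on f (ball 0 r)} \<noteq> {}"
      using inj_on_landau_ball[of 0] landau_radius_fixed_point[OF \<alpha>] by (intro ex_in_conv[THEN iffD1] exI[of _ 0]) auto
    show "r \<le> landau_radius \<alpha>" if "r \<in> {r. 0 \<le> r \<and> r \<le> 1 \<and> inj_on f (ball 0 r)}" for r
      using extremal_not_inj[OF e, of r] that
      by (cases "landau_radius \<alpha> < r") auto
  qed
  then show "inj_radius f = landau_radius \<alpha>" using inj_radius_ge by simp
qed

text \<open>By invariance of domain \<open>f ` ball 0 r\<close> is open. Inside \<open>ball 0 R\<close> it coincides with the closed
  set \<open>f ` cball 0 r\<close>, because the values on the sphere are too large; as it contains 0, it fills the
  connected set \<open>ball 0 R\<close>.\<close>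

lemma ball_subset_image:
  assumes r: "0 < r" "r \<le> landau_radius \<alpha>" and R: "\<And>q. norm q = r \<Longrightarrow> R \<le> norm (f q)"
  shows "ball 0 R \<subseteq> f ` ball 0 r"
proof (rule subsetI, rule ccontr)
  fix w assume w: "w \<in> ball 0 R" "w \<notin> f ` ball 0 r"
  have sub: "cball 0 r \<subseteq> (ball 0 1 :: quat set)" using r landau_radius_fixed_point[OF \<alpha>] \<alpha> by auto
  have "continuous_on (cball 0 r) f" using continuous_f sub by (rule continuous_on_subset)
  then have "compact (f ` cball 0 r)" by (rule compact_continuous_image) simp
  then have closed: "closed (f ` cball 0 r)" by (rule compact_imp_closed)
  have open_im: "open (f ` ball 0 r)"
    using sub ball_subset_cball[of 0 r]
    by (intro invariance_of_domain inj_on_landau_ball r continuous_on_subset[OF continuous_f]) auto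
  have same: "ball 0 R \<inter> f ` cball 0 r \<subseteq> f ` ball 0 r"
  proof
    fix u assume "u \<in> ball 0 R \<inter> f ` cball 0 r"
    then obtain q where q: "u = f q" "norm q \<le> r" "norm (f q) < R" by auto
    then have "norm q \<noteq> r" using R by fastforce
    then show "u \<in> f ` ball 0 r" using q by simp
  qed
  have "connected (ball (0::quat) R)" by simp
  moreover have "f ` ball 0 r \<inter> - f ` cball 0 r \<inter> ball 0 R = {}"
    using image_mono[OF ball_subset_cball[of 0 r], of f] by blast
  moreover have "ball 0 R \<subseteq> f ` ball 0 r \<union> - f ` cball 0 r" using same by blast
  ultimately have "f ` ball 0 r \<inter> ball 0 R = {} \<or> - f ` cball 0 r \<inter> ball 0 R = {}"
    using connectedD[OF _ open_im open_Compl[OF closed]] by meson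
  moreover have "0 \<in> f ` ball 0 r \<inter> ball 0 R"
  proof
    show "0 \<in> f ` ball 0 r" using zero r by (metis centre_in_ball imageI)
    show "0 \<in> ball 0 R" using w(1) norm_ge_zero[of w] by (auto simp del: norm_ge_zero)
  qed
  moreover have "w \<in> - f ` cball 0 r \<inter> ball 0 R" using w same by blast
  ultimately show False by blast
qed

lemma cover_ball_subset_image:
  assumes r: "0 < r" "r \<le> landau_radius \<alpha>"
  shows "ball 0 (cover_radius \<alpha> r) \<subseteq> f ` ball 0 r"
proof (rule ball_subset_image[OF r])
  fix q :: quat assume "norm q = r"
  then show "cover_radius \<alpha> r \<le> norm (f q)"
    using growth[of q] r landau_radius_fixed_point[OF \<alpha>] \<alpha> by (simp add: cover_radius_def)
qed

text \<open>An extremal function takes a value of norm \<open>cover_radius \<alpha> r\<close> on the sphere of radius \<open>r\<close>,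
  and by injectivity nowhere inside. For any other function the minimum of \<open>norm (f q)\<close> on the sphere
  exceeds \<open>cover_radius \<alpha> r\<close>, so a larger ball is covered.\<close>

lemma largest_centred_ball_iff:
  assumes r: "0 < r" "r < landau_radius \<alpha>"
  shows "largest_centred_ball (f ` ball 0 r) (cover_radius \<alpha> r) \<longleftrightarrow> extremal_form \<alpha> f"
proof -
  define R where "R = cover_radius \<alpha> r"
  have r1: "\<bar>r\<bar> < 1" "r < \<alpha>" using r landau_radius_fixed_point[OF \<alpha>] \<alpha> by auto
  have mob_pos: "0 < mob \<alpha> r" using mob_gt_landau_radius[OF \<alpha>, of r] landau_radius_fixed_point[OF \<alpha>] r by simp
  then have R0: "0 < R" using r by (simp add: R_def cover_radius_eq)
  have sub: "ball 0 R \<subseteq> f ` ball 0 r" unfolding R_def using r by (intro cover_ball_subset_image) auto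
  show ?thesis
    unfolding extremal_form_iff[OF \<alpha>] R_def[symmetric]
  proof
    assume largest: "largest_centred_ball (f ` ball 0 r) R"
    show "\<exists>\<eta> W. extremal_series \<alpha> f \<eta> W"
    proof (rule ccontr)
      assume not: "\<nexists>\<eta> W. extremal_series \<alpha> f \<eta> W"
      have "continuous_on (sphere 0 r) (\<lambda>q. norm (f q))"
        using r1 by (intro continuous_on_norm continuous_on_subset[OF continuous_f]) auto
      moreover have "sphere (0::quat) r \<noteq> {}" using r by simp
      ultimately obtain q0 where q0: "q0 \<in> sphere 0 r" "\<And>q. q \<in> sphere 0 r \<Longrightarrow> norm (f q0) \<le> norm (f q)"
        using continuous_attains_inf[OF compact_sphere] by blast
      have nq0: "norm q0 = r" "q0 \<noteq> 0" using q0 r by auto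
      have "R \<le> norm (f q0)" using growth[of q0] nq0 r1 by (simp add: R_def cover_radius_def)
      moreover have "norm (f q0) \<noteq> R"
        using growth_equality[OF nq0(2)] nq0 r1 not by (auto simp: R_def cover_radius_def)
      ultimately have lt: "R < norm (f q0)" by simp
      have "ball 0 (norm (f q0)) \<subseteq> f ` ball 0 r"
        using r q0 by (intro ball_subset_image) auto
      then have "ball (0::quat) (norm (f q0)) \<subseteq> ball 0 R"
        using largest by (simp add: largest_centred_ball_def)
      then show False using lt R0 by (simp add: ball_subset_ball_iff)
    qed
  next
    assume "\<exists>\<eta> W. extremal_series \<alpha> f \<eta> W"
    then obtain \<eta> W where e: "extremal_series \<alpha> f \<eta> W" by blast
    define p where "p = r *\<^sub>R inverse \<eta>"
    have np: "norm p = r" using e r by (simp add: p_def extremal_series_def norm_inverse)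
    have "r * ((r - \<alpha>) / (1 - \<alpha> * r)) = - R"
      unfolding R_def cover_radius_def by (simp add: minus_divide_left algebra_simps)
    then have nfp: "norm (f p) = R"
      using e R0 unfolding p_def extremal_series_value[OF e \<alpha> r1(1)] norm_scaleR extremal_series_def by simp
    have "\<rho> \<le> R" if \<rho>: "ball 0 \<rho> \<subseteq> f ` ball 0 r" for \<rho>
    proof (rule ccontr)
      assume "\<not> \<rho> \<le> R"
      then have "f p \<in> ball 0 \<rho>" using nfp by simp
      then obtain q where q: "q \<in> ball 0 r" "f q = f p" using \<rho> by force
      have "q = p"
        using inj_onD[OF inj_on_landau_ball[OF order_refl] q(2)] q(1) np r by simp
      then show False using q np by simp
    qed
    then show "largest_centred_ball (f ` ball 0 r) R"
      unfolding largest_centred_ball_def using sub subset_ball by blast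
  qed
qed

end

section \<open>The covered ball and the sharpness of the constants\<close>

lemma bounded_class_powser:
  assumes f: "f \<in> bounded_class \<alpha>" and \<alpha>: "0 < \<alpha>" "\<alpha> < 1"
  obtains a where "bounded_quat_powser f a \<alpha>"
proof -
  have f: "f ` ball 0 1 \<subseteq> ball 0 1" "slice_regular_on f (ball 0 1)" "f 0 = 0" "norm (slice_deriv f 0) = \<alpha>"
    using f by (simp_all add: bounded_class_def)
  obtain a where a: "quat_powser a f" using slice_regular_powser[OF f(2)] by blast
  have "bounded_quat_powser f a \<alpha>"
  proof
    show "norm (f q) < 1" if "norm q < 1" for q using f(1) that by (auto simp: image_subset_iff)
  qed (use a f \<alpha> slice_deriv_0[OF f(2) a] in auto)
  then show ?thesis by (rule that)
qed

text \<open>A function that is induced on every slice by one and the same holomorphic function is slice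
  regular.\<close>

lemma slice_regular_on_disc_extension:
  assumes hol: "F holomorphic_on ball 0 1"
    and f: "\<And>I z. I \<in> imag_units \<Longrightarrow> cmod z < 1 \<Longrightarrow> f (slice_of I z) = slice_of I (F z) * v"
  shows "slice_regular_on f (ball 0 1)"
proof -
  have mem: "qpt I x y \<in> ball 0 1 \<longleftrightarrow> cmod (Complex x y) < 1" if "I \<in> imag_units" for I x y
    using that by (simp add: qpt_eq_slice_of norm_slice_of)
  have Fd: "(F has_field_derivative deriv F z) (at z)" if "cmod z < 1" for z
    using holomorphic_derivI[OF hol, of z] that by simp
  have dir: "((\<lambda>t. f (slice_of I (w + of_real t * u))) has_vector_derivative
      slice_of I (u * deriv F (w + of_real s * u)) * v) (at s)"
    if I: "I \<in> imag_units" and s: "cmod (w + of_real s * u) < 1" for I w u s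
  proof (rule has_vector_derivative_transform_within_open)
    have "((\<lambda>t. w + of_real t * u) has_vector_derivative u) (at s)"
      by (auto intro!: derivative_eq_intros)
    from field_vector_diff_chain_at[OF this Fd[OF s]]
    have "((\<lambda>t. F (w + of_real t * u)) has_vector_derivative (u * deriv F (w + of_real s * u))) (at s)"
      by (simp add: o_def)
    moreover have "bounded_linear (\<lambda>z. slice_of I z * v)"
      by (intro bounded_linear_compose[OF bounded_linear_mult_left bounded_linear_slice_of])
    ultimately show "((\<lambda>t. slice_of I (F (w + of_real t * u)) * v) has_vector_derivative
        slice_of I (u * deriv F (w + of_real s * u)) * v) (at s)"
      by (rule bounded_linear.has_vector_derivative[rotated])
    show "open {t. cmod (w + of_real t * u) < 1}"
      by (intro open_Collect_less continuous_intros)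
  qed (use I s f in auto)
  have dx: "((\<lambda>t. f (qpt I t y)) has_vector_derivative slice_of I (deriv F (Complex x y)) * v) (at x)"
    and dy: "((\<lambda>t. f (qpt I x t)) has_vector_derivative slice_of I (\<i> * deriv F (Complex x y)) * v) (at y)"
    if I: "I \<in> imag_units" and xy: "qpt I x y \<in> ball 0 1" for I x y
  proof -
    have n: "cmod (Complex x y) < 1" using mem[OF I] xy by simp
    have e: "\<i> * of_real y + of_real t = Complex t y" "of_real x + of_real t * \<i> = Complex x t" for t
      by (simp_all add: complex_eq_iff)
    show "((\<lambda>t. f (qpt I t y)) has_vector_derivative slice_of I (deriv F (Complex x y)) * v) (at x)"
      using dir[OF I, of "\<i> * of_real y" x 1] n by (simp add: e qpt_eq_slice_of)
    show "((\<lambda>t. f (qpt I x t)) has_vector_derivative slice_of I (\<i> * deriv F (Complex x y)) * v) (at y)"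
      using dir[OF I, of "of_real x" y \<i>] n by (simp add: e qpt_eq_slice_of)
  qed
  have sdx: "slice_dx I f x y = slice_of I (deriv F (Complex x y)) * v"
    and sdy: "slice_dy I f x y = slice_of I (\<i> * deriv F (Complex x y)) * v"
    if "I \<in> imag_units" "qpt I x y \<in> ball 0 1" for I x y
    unfolding slice_dx_def slice_dy_def
    using dx[OF that] dy[OF that] by (simp_all add: vector_derivative_at)
  have cont: "continuous_on {(x, y). qpt I x y \<in> ball 0 1} (\<lambda>(x, y). slice_of I (c * deriv F (Complex x y)) * v)"
    if I: "I \<in> imag_units" for I c
  proof -
    have C: "(\<lambda>p. Complex (fst p) (snd p)) = (\<lambda>p. of_real (fst p) + \<i> * of_real (snd p))"
      by (auto simp: complex_eq_iff)
    have cC: "continuous_on {(x, y). qpt I x y \<in> ball 0 1} (\<lambda>p. Complex (fst p) (snd p))"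
      unfolding C by (intro continuous_intros)
    have cF: "continuous_on (ball 0 1) (deriv F)"
      by (intro holomorphic_on_imp_continuous_on holomorphic_deriv hol) simp
    have "continuous_on {(x, y). qpt I x y \<in> ball 0 1} (\<lambda>p. deriv F (Complex (fst p) (snd p)))"
      by (rule continuous_on_compose2[OF cF cC]) (use mem[OF I] in auto)
    then have "continuous_on {(x, y). qpt I x y \<in> ball 0 1} (\<lambda>p. slice_of I (c * deriv F (Complex (fst p) (snd p))) * v)"
      by (intro continuous_intros bounded_linear.continuous_on[OF bounded_linear_slice_of])
    then show ?thesis by (simp add: case_prod_beta')
  qed
  show ?thesis
    unfolding slice_regular_on_def
  proof (intro conjI ballI allI impI)
    fix I assume I: "I \<in> imag_units"
    show "(\<lambda>t. f (qpt I t y)) differentiable (at x)" "(\<lambda>t. f (qpt I x t)) differentiable (at y)"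
      if "qpt I x y \<in> ball 0 1" for x y
      using dx[OF I that] dy[OF I that] by (auto simp: differentiable_def has_vector_derivative_def)
    show "(1/2) *\<^sub>R (slice_dx I f x y + I * slice_dy I f x y) = 0" if "qpt I x y \<in> ball 0 1" for x y
    proof -
      have "I * slice_of I (\<i> * deriv F (Complex x y)) = - slice_of I (deriv F (Complex x y))"
      proof -
        have "slice_of I \<i> = I" by (simp add: slice_of_alt)
        then have "I * slice_of I (\<i> * deriv F (Complex x y)) = slice_of I (\<i> * (\<i> * deriv F (Complex x y)))"
          by (simp only: slice_of_mult[OF I])
        also have "\<i> * (\<i> * deriv F (Complex x y)) = - deriv F (Complex x y)" by simp
        finally show ?thesis by (simp only: slice_of_minus)
      qed
      then show ?thesis by (simp add: sdx[OF I that] sdy[OF I that] flip: mult.assoc)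
    qed
    show "continuous_on {(x, y). qpt I x y \<in> ball 0 1} (\<lambda>(x, y). slice_dx I f x y)"
      using cont[OF I, of 1] by (rule continuous_on_eq) (auto simp: sdx[OF I])
    show "continuous_on {(x, y). qpt I x y \<in> ball 0 1} (\<lambda>(x, y). slice_dy I f x y)"
      using cont[OF I, of \<i>] by (rule continuous_on_eq) (auto simp: sdy[OF I])
  qed auto
qed

text \<open>The extremal functions with real coefficients, up to the right factor \<open>v\<close>. The factors other
  than \<open>v\<close> commute, so pointwise products suffice. These functions show that the constants are
  attained.\<close>

definition real_extremal :: "real \<Rightarrow> quat \<Rightarrow> quat \<Rightarrow> quat" where
  "real_extremal \<alpha> v q = q * (q - of_real \<alpha>) * inverse (1 - of_real \<alpha> * q) * v"

lemma real_extremal_slice: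
  assumes I: "I \<in> imag_units"
  shows "real_extremal \<alpha> v (slice_of I z) = slice_of I (z * ((z - of_real \<alpha>) / (1 - of_real \<alpha> * z))) * v"
proof -
  have "z * ((z - of_real \<alpha>) / (1 - of_real \<alpha> * z)) = z * (z - of_real \<alpha>) * inverse (1 - of_real \<alpha> * z)"
    by (simp add: divide_inverse)
  then show ?thesis
    by (simp add: real_extremal_def slice_of_mult[OF I] slice_of_inverse[OF I] slice_of_diff)
qed

lemma real_extremal_series:
  assumes \<alpha>: "0 < \<alpha>" "\<alpha> < 1" and v: "norm v = 1"
  shows "extremal_series \<alpha> (real_extremal \<alpha> v) 1 v"
  unfolding extremal_series_def quat_powser_def
proof (intro conjI ballI)
  fix q :: quat assume q: "q \<in> ball 0 1"
  obtain I z where I: "I \<in> imag_units" and qz: "q = slice_of I z" using quat_in_slice by blast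
  have z: "cmod z < 1" using q by (simp add: qz norm_slice_of[OF I])
  have "(\<lambda>n. slice_of I (of_real (mobius_coeff \<alpha> n) * z ^ n) * v) sums real_extremal \<alpha> v q"
    unfolding qz real_extremal_slice[OF I]
    by (intro sums_mult2 bounded_linear.sums[OF bounded_linear_slice_of] mobius_series \<alpha> z)
  then show "(\<lambda>n. q ^ n * (mobius_coeff \<alpha> n *\<^sub>R (1 ^ n * v))) sums real_extremal \<alpha> v q"
    by (simp only: qz slice_of_mult[OF I] slice_of_power[OF I] slice_of_of_real)
      (simp flip: scaleR_conv_of_real)
qed (use v in simp_all)

lemma real_extremal_in_class:
  assumes \<alpha>: "0 < \<alpha>" "\<alpha> < 1" and v: "norm v = 1"
  shows "real_extremal \<alpha> v \<in> bounded_class \<alpha>"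
proof -
  let ?M = "Moebius_function 0 (of_real \<alpha>)"
  have M: "z * ((z - of_real \<alpha>) / (1 - of_real \<alpha> * z)) = z * ?M z" for z
    by (simp add: Moebius_function_simple)
  have "(\<lambda>z. z * ?M z) holomorphic_on ball 0 1"
    using \<alpha> by (intro holomorphic_intros Moebius_function_holomorphic) auto
  then have reg: "slice_regular_on (real_extremal \<alpha> v) (ball 0 1)"
    by (rule slice_regular_on_disc_extension) (simp only: real_extremal_slice M)
  have ps: "quat_powser (\<lambda>n. mobius_coeff \<alpha> n *\<^sub>R (1 ^ n * v)) (real_extremal \<alpha> v)"
    using real_extremal_series[OF assms] by (simp add: extremal_series_def)
  have "norm (real_extremal \<alpha> v q) < 1" if q: "norm q < 1" for q
  proof -
    obtain I z where I: "I \<in> imag_units" and qz: "q = slice_of I z" using quat_in_slice by blast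
    have z: "cmod z < 1" using q by (simp add: qz norm_slice_of[OF I])
    have "cmod z * cmod (?M z) < 1 * 1"
      using z \<alpha> by (intro mult_strict_mono' Moebius_function_norm_lt_1) auto
    then show ?thesis
      unfolding qz real_extremal_slice[OF I] M by (simp add: norm_mult norm_slice_of[OF I] v)
  qed
  moreover have "norm (slice_deriv (real_extremal \<alpha> v) 0) = \<alpha>"
    using slice_deriv_0[OF reg ps] \<alpha> v by simp
  ultimately show ?thesis
    using reg by (auto simp: bounded_class_def real_extremal_def)
qed

text \<open>On a slice the equation is the quadratic \<open>z\<^sup>2 - \<alpha> (1 + t) z + t = 0\<close>. A nonreal root has
  \<open>\<bar>z\<bar>\<^sup>2 = t \<ge> r\<^sup>2\<close>, and a real root \<open>x\<close> has \<open>x * mob \<alpha> x = t \<ge> r * mob \<alpha> r\<close>; neither is possible if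
  \<open>\<bar>z\<bar> < r\<close>.\<close>

lemma real_extremal_omits:
  assumes \<alpha>: "0 < \<alpha>" "\<alpha> < 1" and v: "norm v = 1"
    and r: "0 < r" "r \<le> landau_radius \<alpha>" and t: "cover_radius \<alpha> r \<le> t" and q: "norm q < r"
  shows "real_extremal \<alpha> v q \<noteq> (- t) *\<^sub>R v"
proof
  assume eq: "real_extremal \<alpha> v q = (- t) *\<^sub>R v"
  obtain I z where I: "I \<in> imag_units" and qz: "q = slice_of I z" using quat_in_slice by blast
  have r1: "r < 1" using r landau_radius_fixed_point[OF \<alpha>] \<alpha> by simp
  have z: "cmod z < r" "cmod z < 1" using q r1 by (simp_all add: qz norm_slice_of[OF I])
  have rmob: "r \<le> mob \<alpha> r"
    using mob_gt_landau_radius[OF \<alpha>, of r] landau_radius_fixed_point[OF \<alpha>] r by (cases "r = landau_radius \<alpha>") auto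
  then have t2: "r\<^sup>2 \<le> t" using t r by (simp add: cover_radius_eq power2_eq_square mult_left_mono order_trans[rotated])
  have t0: "0 < t" using t2 r by (smt (verit) zero_less_power)
  have "slice_of I (z * ((z - of_real \<alpha>) / (1 - of_real \<alpha> * z))) * v = slice_of I (of_real (- t)) * v"
    using eq unfolding qz real_extremal_slice[OF I] by (simp add: scaleR_conv_of_real slice_of_minus)
  moreover have "v \<noteq> 0" using v by auto
  ultimately have "z * ((z - of_real \<alpha>) / (1 - of_real \<alpha> * z)) = of_real (- t)"
    using slice_of_eq_iff[OF I] mult_cancel_right by metis
  moreover have "1 - of_real \<alpha> * z \<noteq> 0"
    using disc_one_minus_mult_nonzero[of "of_real \<alpha>" z] z \<alpha> by simp
  ultimately have "z * (z - of_real \<alpha>) = of_real (- t) * (1 - of_real \<alpha> * z)"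
    by (simp add: divide_eq_eq)
  then have re: "(Re z)\<^sup>2 - (Im z)\<^sup>2 - \<alpha> * Re z = - t * (1 - \<alpha> * Re z)"
    and im: "Im z * (2 * Re z - \<alpha> * (1 + t)) = 0"
    by (simp_all add: complex_eq_iff power2_eq_square algebra_simps)
  show False
  proof (cases "Im z = 0")
    case False
    then have "\<alpha> * (1 + t) = 2 * Re z" using im by simp
    moreover have "t = - (Re z)\<^sup>2 + (Im z)\<^sup>2 + \<alpha> * (1 + t) * Re z" using re by (simp add: algebra_simps)
    ultimately have "t = (Re z)\<^sup>2 + (Im z)\<^sup>2" by (simp add: power2_eq_square)
    then have "t = (cmod z)\<^sup>2" by (simp add: cmod_power2)
    also have "\<dots> < r\<^sup>2" using z by (intro power_strict_mono) auto
    finally show False using t2 by simp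
  next
    case True
    define x where "x = Re z"
    have x: "\<bar>x\<bar> < r" "\<bar>x\<bar> < 1" using z abs_Re_le_cmod[of z] by (auto simp: x_def)
    have p: "0 < 1 - \<alpha> * x" by (rule mob_denominator_pos[OF \<alpha> x(2)])
    have "t * (1 - \<alpha> * x) = x * (\<alpha> - x)" using re True by (simp add: x_def power2_eq_square algebra_simps)
    then have tx: "t = x * mob \<alpha> x" using p by (simp add: mob_def field_simps)
    have "0 < x"
    proof (rule ccontr)
      assume "\<not> 0 < x"
      then have "x * mob \<alpha> x \<le> 0" using p \<alpha> by (intro mult_nonpos_nonneg) (auto simp: mob_def)
      then show False using tx t0 by simp
    qed
    then have "x * mob \<alpha> x < r * mob \<alpha> r" using x r by (intro mult_mob_strict_mono[OF \<alpha>]) auto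
    then show False using tx t by (simp add: cover_radius_eq)
  qed
qed

lemma class_inj_radius_eq:
  assumes \<alpha>: "0 < \<alpha>" "\<alpha> < 1"
  shows "class_inj_radius \<alpha> = landau_radius \<alpha>"
  unfolding class_inj_radius_def
proof (rule cInf_eq_minimum)
  have "inj_radius (real_extremal \<alpha> 1) = landau_radius \<alpha>"
  proof -
    obtain a where "bounded_quat_powser (real_extremal \<alpha> 1) a \<alpha>"
      using bounded_class_powser[OF real_extremal_in_class[OF \<alpha> norm_one] \<alpha>] by blast
    moreover have "extremal_form \<alpha> (real_extremal \<alpha> 1)"
      unfolding extremal_form_iff[OF \<alpha>] using real_extremal_series[OF \<alpha> norm_one] by blast
    ultimately show ?thesis by (simp add: bounded_quat_powser.inj_radius_eq_iff)
  qed
  then show "landau_radius \<alpha> \<in> inj_radius ` bounded_class \<alpha>"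
    using real_extremal_in_class[OF \<alpha> norm_one] by (metis imageI)
  show "landau_radius \<alpha> \<le> x" if "x \<in> inj_radius ` bounded_class \<alpha>" for x
    using that bounded_class_powser[OF _ \<alpha>] bounded_quat_powser.inj_radius_ge by blast
qed

text \<open>A point \<open>w\<close> outside the ball is omitted by the real extremal function whose factor \<open>v\<close> points
  in the direction opposite to \<open>w\<close>.\<close>

lemma class_image_Inter:
  assumes \<alpha>: "0 < \<alpha>" "\<alpha> < 1" and r: "0 < r" "r \<le> landau_radius \<alpha>"
  shows "(\<Inter>f\<in>bounded_class \<alpha>. f ` ball 0 r) = ball 0 (cover_radius \<alpha> r)"
proof (intro equalityI INT_greatest)
  fix f assume "f \<in> bounded_class \<alpha>"
  then obtain a where "bounded_quat_powser f a \<alpha>" using bounded_class_powser[OF _ \<alpha>] by blast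
  then show "ball 0 (cover_radius \<alpha> r) \<subseteq> f ` ball 0 r"
    using r by (rule bounded_quat_powser.cover_ball_subset_image)
next
  show "(\<Inter>f\<in>bounded_class \<alpha>. f ` ball 0 r) \<subseteq> ball 0 (cover_radius \<alpha> r)"
  proof (rule subsetI, rule ccontr)
    fix w assume w: "w \<in> (\<Inter>f\<in>bounded_class \<alpha>. f ` ball 0 r)" "w \<notin> ball 0 (cover_radius \<alpha> r)"
    have "0 < cover_radius \<alpha> r"
      using mult_mob_strict_mono[OF \<alpha> order_refl r] by (simp add: cover_radius_eq)
    then have nw: "cover_radius \<alpha> r \<le> norm w" "w \<noteq> 0" using w(2) by auto
    define v where "v = (- inverse (norm w)) *\<^sub>R w"
    have v: "norm v = 1" "w = (- norm w) *\<^sub>R v" using nw by (simp_all add: v_def)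
    have "w \<in> real_extremal \<alpha> v ` ball 0 r" using w(1) real_extremal_in_class[OF \<alpha> v(1)] by blast
    then obtain q where "norm q < r" "real_extremal \<alpha> v q = (- norm w) *\<^sub>R v" using v(2) by auto
    then show False using real_extremal_omits[OF \<alpha> v(1) r nw(1)] by blast
  qed
qed

theorem theorem1p4:
  "(\<forall>\<alpha>\<in>{0<..<1}. class_inj_radius \<alpha> = \<alpha> / (1 + sqrt (1 - \<alpha>\<^sup>2))) \<and>
   (\<forall>\<alpha>\<in>{0<..<1}. \<forall>f\<in>bounded_class \<alpha>.
      inj_radius f \<ge> class_inj_radius \<alpha> \<and>
      (inj_radius f = class_inj_radius \<alpha> \<longleftrightarrow> extremal_form \<alpha> f)) \<and>
   (\<forall>\<alpha>\<in>{0<..<1}. \<forall>r\<in>{0<..class_inj_radius \<alpha>}.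
      (\<Inter>f\<in>bounded_class \<alpha>. f ` ball 0 r) = ball 0 (cover_radius \<alpha> r)) \<and>
   (\<forall>\<alpha>\<in>{0<..<1}. \<forall>r\<in>{0<..<class_inj_radius \<alpha>}. \<forall>f\<in>bounded_class \<alpha>.
      ball 0 (cover_radius \<alpha> r) \<subseteq> f ` ball 0 r \<and>
      (largest_centred_ball (f ` ball 0 r) (cover_radius \<alpha> r) \<longleftrightarrow> extremal_form \<alpha> f))"
proof (intro conjI ballI)
  fix \<alpha> :: real assume "\<alpha> \<in> {0<..<1}"
  then have \<alpha>: "0 < \<alpha>" "\<alpha> < 1" by auto
  show "class_inj_radius \<alpha> = \<alpha> / (1 + sqrt (1 - \<alpha>\<^sup>2))"
    by (simp add: class_inj_radius_eq[OF \<alpha>] landau_radius_def)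
  show "(\<Inter>f\<in>bounded_class \<alpha>. f ` ball 0 r) = ball 0 (cover_radius \<alpha> r)"
    if "r \<in> {0<..class_inj_radius \<alpha>}" for r
    using that by (intro class_image_Inter[OF \<alpha>]) (auto simp: class_inj_radius_eq[OF \<alpha>])
  fix f assume "f \<in> bounded_class \<alpha>"
  then obtain a where "bounded_quat_powser f a \<alpha>" using bounded_class_powser[OF _ \<alpha>] by blast
  then interpret bounded_quat_powser f a \<alpha> .
  show "inj_radius f \<ge> class_inj_radius \<alpha>"
    "inj_radius f = class_inj_radius \<alpha> \<longleftrightarrow> extremal_form \<alpha> f"
    unfolding class_inj_radius_eq[OF \<alpha>] by (rule inj_radius_ge inj_radius_eq_iff)+
  show "ball 0 (cover_radius \<alpha> r) \<subseteq> f ` ball 0 r"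
    "largest_centred_ball (f ` ball 0 r) (cover_radius \<alpha> r) \<longleftrightarrow> extremal_form \<alpha> f"
    if "r \<in> {0<..<class_inj_radius \<alpha>}" for r
    using that cover_ball_subset_image[of r] largest_centred_ball_iff[of r]
    by (auto simp: class_inj_radius_eq[OF \<alpha>])
qed

end
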